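(* Let $f_i:\mathbb{R}^p\to\mathbb{R}$ be differentiable with $L_{f_i}$-Lipschitz gradient ($L_{f_i}>0$) and $r_i:\mathbb{R}^p\to\mathbb{R}\cup\{+\infty\}$ be such that $f_i+r_i$ is proper, lower semicontinuous and coercive, $i=1,\dots,n$. Let $L_f=\max_iL_{f_i}$ and let $W$ be a mixing matrix (see context). Let the step size $\alpha$ satisfy - $0<\alpha<\frac{1+\lambda_n(W)}{L_f}$ if all $r_i$ are convex; - $0<\alpha<\frac{\lambda_n(W)}{L_f}$ if the $r_i$ are not necessarily convex (this case requires $\lambda_n(W)>0$). Let ${\bf x}^0\in\mathbb{R}^{n\times p}$ be arbitrary and let $\{{\bf x}^k\}$ be a sequence generated by Prox-DGD with fixed step size $\alpha$: $${\bf x}^{k+1}\in\mathrm{prox}_{\alpha r}\big(W{\bf x}^k-\alpha\nabla{\bf f}({\bf x}^k)\big),\qquad k=0,1,\dots$$ Let $\hat{\mathcal{L}}_\alpha({\bf x})=\mathcal{L}_\alpha({\bf x})+r({\bf x})$ with $\mathcal{L}_\alpha({\bf x})=\sum_{i=1}^nf_i({\bf x}_{(i)})+\frac{1}{2\alpha}\|{\bf x}\|_{I-W}^2$, and let $\xi^k$ and ${\bf g}^{k}$ be as in the context. Then: (i) $\{{\bf x}^k\}$ has at least one accumulation point, and any accumulation point ${\bf x}^*$ is a stationary point of $\hat{\mathcal{L}}_\alpha$, i.e. $0\in\partial\hat{\mathcal{L}}_\alpha({\bf x}^* )$. (ii) The running best rates of the sequences $\{\|{\bf x}^{k+1}-{\bf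 x}^k\|^2\}$, $\{\|{\bf g}^{k+1}\|^2\}$ and $\{\|\frac1n{\bf 1}^T\nabla{\bf f}({\bf x}^k)+\frac1n{\bf 1}^T\xi^k\|^2\}$ are $o(\frac1k)$. (iii) $\frac1K\sum_{k=0}^{K-1}\|\frac1n{\bf 1}^T(\nabla{\bf f}({\bf x}^k)+\xi^k)\|^2=\mathcal{O}(\frac1K)$. (iv) If, in addition, $\hat{\mathcal{L}}_\alpha$ satisfies the Kurdyka-{\L}ojasiewicz (K{\L}) property at an accumulation point ${\bf x}^*$, then $\{{\bf x}^k\}$ converges to ${\bf x}^*$.
   Context: Notation. $\mathcal{G}=(\mathcal{V},\mathcal{E})$ is a connected undirected graph with $\mathcal{V}=\{1,\dots,n\}$. For ${\bf x}\in\mathbb{R}^{n\times p}$, ${\bf x}_{(i)}\in\mathbb{R}^p$ is its $i$-th row (as a column vector). $\|\cdot\|$ is the Frobenius norm (Euclidean norm for vectors), $\langle\cdot,\cdot\rangle$ the corresponding inner product, and $\|X\|_G^2=\langle X,GX\rangle$ for symmetric positive semidefinite $G\in\mathbb{R}^{n\times n}$. $I$ is the $n\times n$ identity, ${\bf 1}\in\mathbb{R}^n$ the all-ones vector. $\nabla{\bf f}({\bf x})\in\mathbb{R}^{n\times p}$ is the matrix whose $i$-th row is $\nabla f_i({\bf x}_{(i)})^T$, and $r({\bf x})=\sum_{i=1}^nr_i({\bf x}_{(i)})$. The proximal operator is $\mathrm{prox}_{\alpha r}({\bf x})=\mathrm{argmin}_{{\bf u}\in\mathbb{R}^{n\times p}}\{\alpha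 r({\bf u})+\frac12\|{\bf u}-{\bf x}\|^2\}$ (any minimizer may be chosen). A function $h$ is coercive if $\|u\|\to\infty$ implies $h(u)\to+\infty$. $\partial$ denotes the limiting subdifferential (the convex subdifferential for convex functions). Mixing matrix: $W=[w_{ij}]\in\mathbb{R}^{n\times n}$ such that (1) $w_{ij}=0$ if $i\ne j$ and $(i,j)\notin\mathcal{E}$, and $w_{ij}>0$ otherwise; (2) $W=W^T$; (3) $\mathrm{null}(I-W)=\mathrm{span}\{{\bf 1}\}$; (4) $I\succeq W\succ -I$. Its eigenvalues are $1=\lambda_1(W)>\lambda_2(W)\ge\dots\ge\lambda_n(W)>-1$. Subgradients. For $k\ge0$, $\xi^{k+1}\in\partial r({\bf x}^{k+1})$ is the subgradient determined by the proximal step, i.e. ${\bf x}^{k+1}=W{\bf x}^k-\alpha(\nabla{\bf f}({\bf x}^k)+\xi^{k+1})$; $\xi^0\in\mathbb{R}^{n\times p}$ is an arbitrary fixed matrix. ${\bf g}^{k+1}=\nabla\mathcal{L}_\alpha({\bf x}^{k+1})+\xi^{k+1}\in\partial\hat{\mathcal{L}}_\alpha({\bf x}^{k+1})$. Running best rate: a nonnegative sequence $\{a_k\}$ has running best rate $o(1/k)$ if $b_k=\min\{a_i:i\le k\}$ satisfies $b_k=o(1/k)$. K{\L} property: a function $h$ with values in $\mathbb{R}\cup\{+\infty\}$ has the K{\L} property at $x^*\in\mathrm{dom}(\partial h)$ if there exist $\eta\in(0,+\infty]$, a neighborhood $U$ of $x^*$, and a continuous concave function $\varphi:[0,\eta)\to\mathbb{R}_+$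 such that (i) $\varphi(0)=0$ and $\varphi$ is differentiable on $(0,\eta)$; (ii) $\varphi'(s)>0$ for all $s\in(0,\eta)$; (iii) for all $x\in U$ with $h(x^* )<h(x)<h(x^* )+\eta$, $\varphi'(h(x)-h(x^* ))\cdot\mathrm{dist}(0,\partial h(x))\ge1$. $\mathbb{R}^{n\times p}$ is identified with $\mathbb{R}^{np}$. *)

theory Defs
  imports "HOL-Analysis.Analysis" "HOL-Library.Landau_Symbols"
begin

definition gradient :: "('a::real_inner \<Rightarrow> real) \<Rightarrow> 'a \<Rightarrow> 'a" where
  "gradient f x = (THE D. GDERIV f x :> D)"

definition proper :: "('a \<Rightarrow> ereal) \<Rightarrow> bool" where
  "proper h \<longleftrightarrow> (\<forall>x. h x \<noteq> -\<infinity>) \<and> (\<exists>x. h x \<noteq> \<infinity>)"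

definition lower_semicontinuous :: "('a::topological_space \<Rightarrow> ereal) \<Rightarrow> bool" where
  "lower_semicontinuous h \<longleftrightarrow> (\<forall>x. h x \<le> Liminf (at x) h)"

definition coercive :: "('a::real_normed_vector \<Rightarrow> ereal) \<Rightarrow> bool" where
  "coercive h \<longleftrightarrow> (h \<longlongrightarrow> \<infinity>) at_infinity"

definition ereal_convex :: "('a::real_vector \<Rightarrow> ereal) \<Rightarrow> bool" where
  "ereal_convex h \<longleftrightarrow> (\<forall>x y. \<forall>t\<in>{0<..<1::real}.
     h ((1 - t) *\<^sub>R x + t *\<^sub>R y) \<le> ereal (1 - t) * h x + ereal t * h y)"

definition frechet_subdiff :: "('a::real_inner \<Rightarrow> ereal) \<Rightarrow> 'a \<Rightarrow> 'a set" where
  "frechet_subdiff h x = {v. \<bar>h x\<bar> \<noteq> \<infinity> \<and>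
     0 \<le> Liminf (at x) (\<lambda>y. (h y - h x - ereal (inner v (y - x))) / ereal (norm (y - x)))}"

text \<open>The limiting subdifferential; \<open>subdiff_convex\<close> below shows that no separate convention is
  needed for convex functions. All subdifferentials are empty where \<open>h\<close> is infinite.\<close>

definition subdiff :: "('a::real_inner \<Rightarrow> ereal) \<Rightarrow> 'a \<Rightarrow> 'a set" where
  "subdiff h x = {v. \<bar>h x\<bar> \<noteq> \<infinity> \<and> (\<exists>y u.
     y \<longlonglongrightarrow> x \<and> (\<lambda>k. h (y k)) \<longlonglongrightarrow> h x \<and>
     (\<forall>k. u k \<in> frechet_subdiff h (y k)) \<and> u \<longlonglongrightarrow> v)}"

definition convex_subdiff :: "('a::real_inner \<Rightarrow> ereal) \<Rightarrow> 'a \<Rightarrow> 'a set" where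
  "convex_subdiff h x = {v. \<bar>h x\<bar> \<noteq> \<infinity> \<and> (\<forall>y. h x + ereal (inner v (y - x)) \<le> h y)}"

lemma frechet_subdiff_subset: "frechet_subdiff h x \<subseteq> subdiff h x"
proof
  fix v assume v: "v \<in> frechet_subdiff h x"
  have "\<exists>y u. y \<longlonglongrightarrow> x \<and> (\<lambda>k. h (y k)) \<longlonglongrightarrow> h x \<and>
     (\<forall>k. u k \<in> frechet_subdiff h (y k)) \<and> u \<longlonglongrightarrow> v"
    by (rule exI[of _ "\<lambda>_. x"], rule exI[of _ "\<lambda>_. v"]) (simp add: v)
  then show "v \<in> subdiff h x"
    using v by (simp add: subdiff_def frechet_subdiff_def)
qed

lemma frechet_subdiffI:
  assumes fin: "\<bar>h x\<bar> \<noteq> \<infinity>"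
    and lb: "\<And>y. h x + ereal (inner v (y - x) - c * (norm (y - x))\<^sup>2) \<le> h y"
  shows "v \<in> frechet_subdiff h x"
proof -
  obtain a where a: "h x = ereal a" using fin by (cases "h x") auto
  have "0 \<le> Liminf (at x) (\<lambda>y. (h y - h x - ereal (inner v (y - x))) / ereal (norm (y - x)))"
    unfolding le_Liminf_iff
  proof (intro allI impI)
    fix z :: ereal assume z: "z < 0"
    obtain e :: real where e: "e > 0" "z < ereal (- e)"
    proof (cases z)
      case (real r) with z show ?thesis by (intro that[of "- r / 2"]) auto
    next
      case PInf with z show ?thesis by simp
    next
      case MInf then show ?thesis by (intro that[of 1]) auto
    qed
    define d where "d = e / (\<bar>c\<bar> + 1)"
    have d: "d > 0" using e by (simp add: d_def)
    show "\<forall>\<^sub>F y in at x. z < (h y - h x - ereal (inner v (y - x))) / ereal (norm (y - x))"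
      unfolding eventually_at
    proof (intro exI conjI ballI impI)
      show "d > 0" by fact
      fix y assume "y \<noteq> x \<and> dist y x < d"
      then have n: "norm (y - x) > 0" "norm (y - x) < d" by (auto simp: dist_norm)
      let ?n = "norm (y - x)"
      have "c * ?n \<le> (\<bar>c\<bar> + 1) * ?n" using n by (intro mult_right_mono) auto
      also have "\<dots> < (\<bar>c\<bar> + 1) * d" using n by (intro mult_strict_left_mono) auto
      also have "\<dots> = e" by (simp add: d_def)
      finally have cn: "- e < - (c * ?n)" by simp
      have "z < (h y - h x - ereal (inner v (y - x))) / ereal ?n"
      proof (cases "h y")
        case (real b)
        have "a + (inner v (y - x) - c * ?n\<^sup>2) \<le> b" using lb[of y] a real by simp
        then have "- (c * ?n) * ?n \<le> b - a - inner v (y - x)"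
          by (simp add: power2_eq_square algebra_simps)
        then have "- (c * ?n) \<le> (b - a - inner v (y - x)) / ?n"
          using n by (simp add: pos_le_divide_eq)
        then have "- e \<le> (b - a - inner v (y - x)) / ?n" using cn by simp
        then have "ereal (- e) \<le> (h y - h x - ereal (inner v (y - x))) / ereal ?n"
          using real a n by simp
        with e(2) show ?thesis by (rule less_le_trans)
      next
        case PInf
        then have "(h y - h x - ereal (inner v (y - x))) / ereal ?n = \<infinity>"
          using a n by simp
        then show ?thesis using z by auto
      next
        case MInf
        then show ?thesis using lb[of y] a by simp
      qed
      then show "z < (h y - h x - ereal (inner v (y - x))) / ereal (norm (y - x))" .
    qed
  qed
  with fin show ?thesis by (simp add: frechet_subdiff_def)
qed

lemma frechet_subdiff_convex:
  assumes conv: "ereal_convex h" and ninf: "\<And>x. h x \<noteq> -\<infinity>"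
  shows "frechet_subdiff h x \<subseteq> convex_subdiff h x"
proof
  fix v assume v: "v \<in> frechet_subdiff h x"
  then have fin: "\<bar>h x\<bar> \<noteq> \<infinity>" and
    L: "0 \<le> Liminf (at x) (\<lambda>y. (h y - h x - ereal (inner v (y - x))) / ereal (norm (y - x)))"
    by (auto simp: frechet_subdiff_def)
  obtain a where a: "h x = ereal a" using fin by (cases "h x") auto
  have "h x + ereal (inner v (y - x)) \<le> h y" for y
  proof (cases "h y")
    case PInf then show ?thesis by simp
  next
    case MInf with ninf show ?thesis by simp
  next
    case (real b)
    show ?thesis
    proof (cases "y = x")
      case True with a show ?thesis by simp
    next
      case False
      let ?n = "norm (y - x)"
      have n: "?n > 0" using False by simp
      have *: "a + inner v (y - x) - e * ?n \<le> b" if e: "e > 0" for e :: real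
      proof -
        have "ereal (- e) < 0" using e by simp
        with L have "\<forall>\<^sub>F w in at x. ereal (- e) <
            (h w - h x - ereal (inner v (w - x))) / ereal (norm (w - x))"
          unfolding le_Liminf_iff by blast
        then obtain d where d: "d > 0" "\<And>w. w \<noteq> x \<Longrightarrow> dist w x < d \<Longrightarrow> ereal (- e) <
            (h w - h x - ereal (inner v (w - x))) / ereal (norm (w - x))"
          unfolding eventually_at by auto
        define t where "t = min (1/2) (d / (2 * ?n))"
        have t: "0 < t" "t < 1" using d n by (auto simp: t_def)
        have "t * ?n \<le> d / (2 * ?n) * ?n" by (intro mult_right_mono) (auto simp: t_def)
        then have tn: "t * ?n < d" using n d by (simp add: field_simps)
        define w where "w = (1 - t) *\<^sub>R x + t *\<^sub>R y"
        have wx: "w - x = t *\<^sub>R (y - x)" by (simp add: w_def algebra_simps)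
        have nw: "norm (w - x) = t * ?n" using t by (simp add: wx)
        then have "w \<noteq> x" "dist w x < d" using t n tn by (auto simp: dist_norm)
        then have q: "ereal (- e) < (h w - h x - ereal (inner v (w - x))) / ereal (norm (w - x))"
          by (rule d(2))
        have "h w \<le> ereal (1 - t) * h x + ereal t * h y"
          using conv t by (simp add: ereal_convex_def w_def)
        then have hw: "h w \<le> ereal ((1 - t) * a + t * b)" using a real by simp
        then obtain c where c: "h w = ereal c" using ninf[of w] by (cases "h w") auto
        have cb: "c \<le> (1 - t) * a + t * b" using hw c by simp
        have "- e < (c - a - t * inner v (y - x)) / (t * ?n)"
          using q a c nw t n by (simp add: wx)
        then have "- e * (t * ?n) < c - a - t * inner v (y - x)"
          using t n by (simp add: pos_less_divide_eq)
        then have "t * (a + inner v (y - x) - e * ?n) < t * b"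
          using cb by (simp add: algebra_simps)
        then show ?thesis using t by simp
      qed
      have "a + inner v (y - x) \<le> b"
      proof (rule field_le_epsilon)
        fix e :: real assume "e > 0"
        then show "a + inner v (y - x) \<le> b + e" using *[of "e / ?n"] n by simp
      qed
      then show ?thesis using a real by simp
    qed
  qed
  with fin show "v \<in> convex_subdiff h x" by (simp add: convex_subdiff_def)
qed

lemma subdiff_convex:
  assumes conv: "ereal_convex h" and ninf: "\<And>x. h x \<noteq> -\<infinity>"
  shows "subdiff h x = convex_subdiff h x"
proof
  show "convex_subdiff h x \<subseteq> subdiff h x"
    using frechet_subdiffI[of h x _ 0] frechet_subdiff_subset[of h x]
    by (auto simp: convex_subdiff_def)
  show "subdiff h x \<subseteq> convex_subdiff h x"
  proof
    fix v assume "v \<in> subdiff h x"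
    then obtain y u where fin: "\<bar>h x\<bar> \<noteq> \<infinity>" and y: "y \<longlonglongrightarrow> x"
      and hy: "(\<lambda>k. h (y k)) \<longlonglongrightarrow> h x" and u: "\<And>k. u k \<in> frechet_subdiff h (y k)" and uv: "u \<longlonglongrightarrow> v"
      by (auto simp: subdiff_def)
    have "h x + ereal (inner v (w - x)) \<le> h w" for w
    proof (rule LIMSEQ_le_const2)
      show "(\<lambda>k. h (y k) + ereal (inner (u k) (w - y k))) \<longlonglongrightarrow> h x + ereal (inner v (w - x))"
        using fin by (intro tendsto_add_ereal hy tendsto_ereal tendsto_inner uv tendsto_diff y) auto
      show "\<exists>N. \<forall>k\<ge>N. h (y k) + ereal (inner (u k) (w - y k)) \<le> h w"
        using u frechet_subdiff_convex[OF conv ninf] by (fastforce simp: convex_subdiff_def)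
    qed
    with fin show "v \<in> convex_subdiff h x" by (simp add: convex_subdiff_def)
  qed
qed

text \<open>The distance takes values in the extended reals so that the distance to the empty set
  is \<open>\<infinity>\<close>; the library's \<open>infdist\<close> would give 0.\<close>

definition dist_zero :: "'a::real_normed_vector set \<Rightarrow> ereal" where
  "dist_zero S = (INF v\<in>S. ereal (norm v))"

definition KL_property :: "('a::real_inner \<Rightarrow> ereal) \<Rightarrow> 'a \<Rightarrow> bool" where
  "KL_property h xs \<longleftrightarrow> subdiff h xs \<noteq> {} \<and>
     (\<exists>\<eta>::ereal. \<exists>U. \<exists>\<phi>::real \<Rightarrow> real. 0 < \<eta> \<and> open U \<and> xs \<in> U \<and>
        continuous_on {s. 0 \<le> s \<and> ereal s < \<eta>} \<phi> \<and>
        concave_on {s. 0 \<le> s \<and> ereal s < \<eta>} \<phi> \<and>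
        (\<forall>s. 0 \<le> s \<and> ereal s < \<eta> \<longrightarrow> 0 \<le> \<phi> s) \<and>
        \<phi> 0 = 0 \<and>
        (\<forall>s. 0 < s \<and> ereal s < \<eta> \<longrightarrow> \<phi> differentiable (at s) \<and> 0 < deriv \<phi> s) \<and>
        (\<forall>x\<in>U. h xs < h x \<and> h x < h xs + \<eta> \<longrightarrow>
           1 \<le> ereal (deriv \<phi> (real_of_ereal (h x - h xs))) * dist_zero (subdiff h x)))"

text \<open>The vertex set is the finite index type; an undirected graph is a symmetric set of
  ordered pairs.\<close>

definition connected_graph :: "('n \<times> 'n) set \<Rightarrow> bool" where
  "connected_graph E \<longleftrightarrow> sym E \<and> (\<forall>i j. (i, j) \<in> E\<^sup>*)"

definition mixing_matrix :: "('n \<times> 'n) set \<Rightarrow> real^'n^'n::finite \<Rightarrow> bool" where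
  "mixing_matrix E W \<longleftrightarrow>
     (\<forall>i j. if i \<noteq> j \<and> (i, j) \<notin> E then W $ i $ j = 0 else W $ i $ j > 0) \<and>
     transpose W = W \<and>
     {v. (mat 1 - W) *v v = 0} = span {1} \<and>
     (\<forall>v. inner v ((mat 1 - W) *v v) \<ge> 0) \<and>
     (\<forall>v. v \<noteq> 0 \<longrightarrow> inner v ((W + mat 1) *v v) > 0)"

definition eigenvalues :: "real^'n^'n::finite \<Rightarrow> real set" where
  "eigenvalues A = {l. \<exists>v. v \<noteq> 0 \<and> A *v v = l *\<^sub>R v}"

definition lambda_min :: "real^'n^'n::finite \<Rightarrow> real" where
  "lambda_min A = Min (eigenvalues A)"

text \<open>An \<open>n \<times> p\<close> matrix has type \<^typ>\<open>real^'p^'n\<close>, so that \<open>x $ i\<close> is its \<open>i\<close>-th row; the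
  norm and inner product of that type are the Frobenius ones.\<close>

definition prox :: "('a::real_normed_vector \<Rightarrow> ereal) \<Rightarrow> 'a \<Rightarrow> 'a set" where
  "prox h v = {u. is_arg_min (\<lambda>u. h u + ereal (1/2 * (norm (u - v))\<^sup>2)) (\<lambda>_. True) u}"

definition grad_rows :: "('n \<Rightarrow> real^'p \<Rightarrow> real) \<Rightarrow> real^'p^'n \<Rightarrow> real^'p^'n::finite" where
  "grad_rows f x = (\<chi> i. gradient (f i) (x $ i))"

definition row_sum :: "('n \<Rightarrow> real^'p \<Rightarrow> ereal) \<Rightarrow> real^'p^'n::finite \<Rightarrow> ereal" where
  "row_sum r x = (\<Sum>i\<in>UNIV. r i (x $ i))"

definition smooth_lagrangian ::
    "('n \<Rightarrow> real^'p \<Rightarrow> real) \<Rightarrow> real^'n^'n \<Rightarrow> real \<Rightarrow> real^'p^'n::finite \<Rightarrow> real" where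
  "smooth_lagrangian f W \<alpha> x =
     (\<Sum>i\<in>UNIV. f i (x $ i)) + 1 / (2 * \<alpha>) * inner x ((mat 1 - W) ** x)"

definition lagrangian ::
    "('n \<Rightarrow> real^'p \<Rightarrow> real) \<Rightarrow> ('n \<Rightarrow> real^'p \<Rightarrow> ereal) \<Rightarrow> real^'n^'n \<Rightarrow> real
       \<Rightarrow> real^'p^'n::finite \<Rightarrow> ereal" where
  "lagrangian f r W \<alpha> x = ereal (smooth_lagrangian f W \<alpha> x) + row_sum r x"

definition prox_dgd ::
    "('n \<Rightarrow> real^'p \<Rightarrow> real) \<Rightarrow> ('n \<Rightarrow> real^'p \<Rightarrow> ereal) \<Rightarrow> real^'n^'n \<Rightarrow> real
       \<Rightarrow> (nat \<Rightarrow> real^'p^'n::finite) \<Rightarrow> bool" where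
  "prox_dgd f r W \<alpha> x \<longleftrightarrow>
     (\<forall>k. x (Suc k) \<in> prox (\<lambda>u. ereal \<alpha> * row_sum r u) (W ** x k - \<alpha> *\<^sub>R grad_rows f (x k)))"

definition row_average :: "real^'p^'n \<Rightarrow> real^'p" where
  "row_average M = (1 / real CARD('n::finite)) *\<^sub>R ((1::real^'n) v* M)"

definition accumulation_point :: "(nat \<Rightarrow> 'a::topological_space) \<Rightarrow> 'a \<Rightarrow> bool" where
  "accumulation_point x l \<longleftrightarrow> (\<exists>s. strict_mono s \<and> (x \<circ> s) \<longlonglongrightarrow> l)"

definition running_best :: "(nat \<Rightarrow> real) \<Rightarrow> nat \<Rightarrow> real" where
  "running_best a k = Min (a ` {..k})"

text \<open>With \<open>h = row_sum r\<close> this shows that a sequence \<open>\<xi>\<close> with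
  \<open>x (Suc k) = W ** x k - \<alpha> *\<^sub>R (grad_rows f (x k) + \<xi> (Suc k))\<close> along a Prox-DGD run consists, from index 1
  on, of subgradients of \<open>row_sum r\<close> at the iterates, so this need not be assumed separately.\<close>

lemma prox_subgradient:
  fixes h :: "'a::real_inner \<Rightarrow> ereal"
  assumes h: "proper h" and \<alpha>: "\<alpha> > 0"
    and z: "z \<in> prox (\<lambda>u. ereal \<alpha> * h u) v"
    and \<xi>: "z = v - \<alpha> *\<^sub>R \<xi>"
  shows "\<xi> \<in> subdiff h z"
proof -
  have ninf: "h u \<noteq> -\<infinity>" for u using h by (simp add: proper_def)
  obtain u0 where u0: "h u0 \<noteq> \<infinity>" using h by (auto simp: proper_def)
  have le: "ereal \<alpha> * h z + ereal (1/2 * (norm (z - v))\<^sup>2)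
      \<le> ereal \<alpha> * h u + ereal (1/2 * (norm (u - v))\<^sup>2)" for u
    using z by (simp add: prox_def is_arg_min_linorder)
  obtain b0 where b0: "h u0 = ereal b0" using u0 ninf[of u0] by (cases "h u0") auto
  have "h z \<noteq> \<infinity>"
    using le[of u0] b0 \<alpha> by auto
  then obtain a where a: "h z = ereal a" using ninf[of z] by (cases "h z") auto
  have "\<xi> \<in> frechet_subdiff h z"
  proof (rule frechet_subdiffI)
    show "\<bar>h z\<bar> \<noteq> \<infinity>" using a by simp
    fix u
    show "h z + ereal (inner \<xi> (u - z) - 1 / (2 * \<alpha>) * (norm (u - z))\<^sup>2) \<le> h u"
    proof (cases "h u")
      case (real b)
      define d where "d = u - z"
      have "u - v = d - \<alpha> *\<^sub>R \<xi>" "z - v = - (\<alpha> *\<^sub>R \<xi>)" by (simp_all add: \<xi> d_def)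
      then have "(norm (u - v))\<^sup>2 = (norm d)\<^sup>2 - 2 * \<alpha> * inner \<xi> d + (norm (z - v))\<^sup>2"
        by (simp only: power2_norm_eq_inner) (simp add: inner_diff inner_commute algebra_simps)
      then have n: "(norm (u - v))\<^sup>2 = (norm (u - z))\<^sup>2 - 2 * \<alpha> * inner \<xi> (u - z) + (norm (z - v))\<^sup>2"
        by (simp add: d_def)
      have "\<alpha> * a + 1/2 * (norm (z - v))\<^sup>2 \<le> \<alpha> * b + 1/2 * (norm (u - v))\<^sup>2"
        using le[of u] a real by simp
      then have "\<alpha> * (a + inner \<xi> (u - z)) - 1/2 * (norm (u - z))\<^sup>2 \<le> \<alpha> * b"
        unfolding n by (simp add: algebra_simps)
      then have "a + (inner \<xi> (u - z) - 1 / (2 * \<alpha>) * (norm (u - z))\<^sup>2) \<le> b"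
        using \<alpha> by (simp add: field_simps)
      then show ?thesis using a real by simp
    qed (use ninf in auto)
  qed
  then show ?thesis using frechet_subdiff_subset by blast
qed

end

theory Submission
  imports Defs
begin

text \<open>
  The gradient of the smooth Lagrangian is \<open>G = \<nabla>f + (I - W) / \<alpha>\<close>, so \<open>W x - \<alpha> \<nabla>f(x) = x - \<alpha> G(x)\<close>:
  Prox-DGD is the proximal gradient method with step size \<open>\<alpha>\<close> for the Lagrangian, which splits into a
  smooth part \<open>F\<close> and the nonsmooth part \<open>R\<close>. The locale \<open>proximal_gradient\<close> analyses that method.

  The curvature of \<open>F\<close> from above is at most \<open>M = L + (1 - \<lambda>) / \<alpha>\<close>, where \<open>\<lambda>\<close> is the least eigenvalue
  of \<open>W\<close> (\<open>smooth_lagrangian_upper_bound\<close>, by way of the Rayleigh quotient). The proximal step compares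
  \<open>R\<close> at two consecutive iterates. Together these facts make the objective decrease at every step by
  a fixed multiple of the squared step length (\<open>val_descent\<close>) as soon as \<open>\<alpha> M < 1\<close>, or \<open>\<alpha> M < 2\<close> if
  \<open>R\<close> is convex. These are exactly the two step size conditions.

  Coercivity confines the iterates to a bounded sublevel set, so accumulation points exist. Lower
  semicontinuity bounds the values from below, so the squared step lengths are summable. The
  subgradient \<open>G (x (k+1)) - G (x k) - (x (k+1) - x k) / \<alpha>\<close> of the objective at \<open>x (k+1)\<close> is at most a
  constant times the step length, so its squared norms are summable as well, and so are those of its
  row averages, where the consensus term cancels. Summability gives all the rates
  (\<open>running_best_smallo\<close>, \<open>averages_bigo\<close>). Along a convergent subsequence the subgradients tend to 0
  and the values tend to the value at the limit (\<open>val_tendsto\<close>), so the limit is stationary.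

  Under the Kurdyka-Lojasiewicz property a quantity that combines the distance to the accumulation
  point, the step length and the desingularized excess value cannot increase near that point and
  tends to 0 along a subsequence; this traps the whole sequence (\<open>KL_descent_convergence\<close>).
\<close>

section \<open>Lower semicontinuous extended-valued functions\<close>

lemma lower_semicontinuous_iff_nhds:
  "lower_semicontinuous h \<longleftrightarrow> (\<forall>x. h x \<le> Liminf (nhds x) h)"
  unfolding lower_semicontinuous_def le_Liminf_iff eventually_nhds_conv_at by blast

lemma lower_semicontinuous_seq:
  assumes "lower_semicontinuous h" and "y \<longlonglongrightarrow> x"
  shows "h x \<le> liminf (\<lambda>k. h (y k))"
  unfolding le_Liminf_iff
proof (intro allI impI)
  fix c assume "c < h x"
  then have "\<forall>\<^sub>F z in nhds x. c < h z"
    using assms(1) unfolding lower_semicontinuous_iff_nhds le_Liminf_iff by blast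
  then show "\<forall>\<^sub>F k in sequentially. c < h (y k)"
    using assms(2) by (rule eventually_compose_filterlim)
qed

lemma lower_semicontinuous_compose:
  fixes \<phi> :: "'a::t2_space \<Rightarrow> 'b::topological_space"
  assumes "lower_semicontinuous h" and "\<And>x. isCont \<phi> x"
  shows "lower_semicontinuous (\<lambda>x. h (\<phi> x))"
  unfolding lower_semicontinuous_iff_nhds le_Liminf_iff
proof (intro allI impI)
  fix x c assume "c < h (\<phi> x)"
  then have "\<forall>\<^sub>F z in nhds (\<phi> x). c < h z"
    using assms(1) unfolding lower_semicontinuous_iff_nhds le_Liminf_iff by blast
  moreover have "filterlim \<phi> (nhds (\<phi> x)) (nhds x)"
    using assms(2) by (simp add: continuous_at_imp_continuous_at_within isCont_def tendsto_at_iff_tendsto_nhds)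
  ultimately show "\<forall>\<^sub>F z in nhds x. c < h (\<phi> z)"
    by (rule eventually_compose_filterlim)
qed

lemma lower_semicontinuous_continuous:
  fixes \<phi> :: "'a::t2_space \<Rightarrow> real"
  assumes "\<And>x. isCont \<phi> x"
  shows "lower_semicontinuous (\<lambda>x. ereal (\<phi> x))"
  unfolding lower_semicontinuous_def
proof
  fix x
  have "((\<lambda>x. ereal (\<phi> x)) \<longlongrightarrow> ereal (\<phi> x)) (at x)"
    using assms[of x] by (intro tendsto_ereal) (simp add: isCont_def)
  then show "ereal (\<phi> x) \<le> Liminf (at x) (\<lambda>x. ereal (\<phi> x))"
    by (cases "at x = bot") (simp_all only: Liminf_bot lim_imp_Liminf top_greatest order_refl not_False_eq_True)
qed

lemma ereal_less_add_split:
  fixes a b c :: ereal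
  assumes c: "c < a + b" and "a \<noteq> -\<infinity>" "b \<noteq> -\<infinity>"
  obtains c1 c2 where "c1 < a" "c2 < b" "c \<le> c1 + c2"
proof -
  obtain m where m: "c < ereal m" "ereal m < a + b" using c ereal_dense2 by blast
  show thesis
  proof (cases a; cases b)
    fix s t assume st: "a = ereal s" "b = ereal t"
    then have "m < s + t" using m by simp
    then show thesis
      using m st by (intro that[of "ereal (s - (s + t - m) / 2)" "ereal (t - (s + t - m) / 2)"])
        (auto simp: field_simps)
  next
    fix s assume "a = ereal s" "b = \<infinity>"
    then show thesis
      using m by (intro that[of "ereal (s - 1)" "ereal (m - s + 1)"]) auto
  next
    fix t assume "a = \<infinity>" "b = ereal t"
    then show thesis
      using m by (intro that[of "ereal (m - t + 1)" "ereal (t - 1)"]) auto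
  next
    assume "a = \<infinity>" "b = \<infinity>"
    then show thesis
      using m by (intro that[of "ereal m" 0]) auto
  qed (use assms in auto)
qed

lemma lower_semicontinuous_add:
  assumes "lower_semicontinuous h" "lower_semicontinuous k"
    and "\<And>x. h x \<noteq> -\<infinity>" "\<And>x. k x \<noteq> -\<infinity>"
  shows "lower_semicontinuous (\<lambda>x. h x + k x)"
  unfolding lower_semicontinuous_iff_nhds le_Liminf_iff
proof (intro allI impI)
  fix x c assume "c < h x + k x"
  then obtain c1 c2 where c: "c1 < h x" "c2 < k x" "c \<le> c1 + c2"
    using assms(3,4)[of x] by (rule ereal_less_add_split)
  have "\<forall>\<^sub>F z in nhds x. c1 < h z" "\<forall>\<^sub>F z in nhds x. c2 < k z"
    using c assms unfolding lower_semicontinuous_iff_nhds le_Liminf_iff by blast+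
  then show "\<forall>\<^sub>F z in nhds x. c < h z + k z"
  proof eventually_elim
    case (elim z)
    then have "c1 + c2 < h z + k z" by (rule ereal_add_strict_mono2)
    with c(3) show ?case by (rule le_less_trans)
  qed
qed

lemma sum_not_MInfty:
  fixes h :: "'i \<Rightarrow> ereal"
  assumes "\<And>i. i \<in> I \<Longrightarrow> h i \<noteq> -\<infinity>"
  shows "(\<Sum>i\<in>I. h i) \<noteq> -\<infinity>"
  using assms by (induction I rule: infinite_finite_induct) auto

lemma lower_semicontinuous_sum:
  fixes h :: "'i \<Rightarrow> 'a::t2_space \<Rightarrow> ereal"
  assumes "finite I" and "\<And>i. i \<in> I \<Longrightarrow> lower_semicontinuous (h i)"
    and "\<And>i x. i \<in> I \<Longrightarrow> h i x \<noteq> -\<infinity>"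
  shows "lower_semicontinuous (\<lambda>x. \<Sum>i\<in>I. h i x)"
  using assms
proof (induction I)
  case empty
  show ?case
    using lower_semicontinuous_continuous[of "\<lambda>_::'a. 0"] by (simp add: zero_ereal_def)
next
  case (insert i I)
  then show ?case
    by (simp add: lower_semicontinuous_add sum_not_MInfty)
qed

text \<open>Coercivity confines the search for an unbounded-below sequence to a ball; a convergent
  subsequence would then force the value \<open>-\<infinity>\<close> at its limit.\<close>

lemma coercive_lsc_bounded_below:
  fixes h :: "'a::euclidean_space \<Rightarrow> ereal"
  assumes lsc: "lower_semicontinuous h" and co: "coercive h" and ninf: "\<And>x. h x \<noteq> -\<infinity>"
  shows "\<exists>m::real. \<forall>x. ereal m \<le> h x"
proof (rule ccontr)
  assume neg: "\<not> ?thesis"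
  have "\<forall>n::nat. \<exists>x. h x < ereal (- real n)"
    using neg by (metis not_le)
  then obtain y where y: "\<And>n::nat. h (y n) < ereal (- real n)" by metis
  have "\<forall>\<^sub>F x in at_infinity. (0::ereal) < h x"
    using co unfolding coercive_def by (rule order_tendstoD) simp
  then obtain b where b: "\<And>x. b \<le> norm x \<Longrightarrow> 0 < h x"
    unfolding eventually_at_infinity by blast
  have "norm (y n) \<le> b" for n
    using b[of "y n"] y[of n] by (cases "b \<le> norm (y n)") (auto dest: less_trans simp: zero_ereal_def)
  then have "bounded (range y)" by (auto simp: bounded_iff)
  then obtain l \<sigma> where \<sigma>: "strict_mono \<sigma>" and lim: "(y \<circ> \<sigma>) \<longlonglongrightarrow> l"
    using bounded_imp_convergent_subsequence by blast
  have "h l \<le> ereal (- real N)" for N :: nat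
  proof -
    have "h l \<le> liminf (\<lambda>k. h ((y \<circ> \<sigma>) k))"
      using lower_semicontinuous_seq[OF lsc lim] .
    also have "\<dots> \<le> liminf (\<lambda>k. ereal (- real N))"
    proof (intro Liminf_mono eventually_sequentiallyI[of N])
      fix k assume "N \<le> k"
      then have "N \<le> \<sigma> k" using seq_suble[OF \<sigma>, of k] by simp
      then have "ereal (- real (\<sigma> k)) \<le> ereal (- real N)" by simp
      then show "h ((y \<circ> \<sigma>) k) \<le> ereal (- real N)"
        using less_le_trans[OF y[of "\<sigma> k"]] by (simp add: less_imp_le del: ereal_less_eq)
    qed
    finally show ?thesis by (simp add: Liminf_const)
  qed
  then have "h l = -\<infinity>"
    by (metis ereal_bot linear neg reals_Archimedean2 order_trans ereal_less_eq(3) minus_le_iff less_imp_le)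
  then show False using ninf by simp
qed

lemma coercive_sublevel_bounded:
  fixes h :: "'a::real_normed_vector \<Rightarrow> ereal"
  assumes "coercive h"
  shows "\<exists>b. \<forall>x. h x \<le> ereal c \<longrightarrow> norm x \<le> b"
proof -
  have "\<forall>\<^sub>F x in at_infinity. ereal c < h x"
    using assms unfolding coercive_def by (rule order_tendstoD) simp
  then obtain b where b: "\<And>x. b \<le> norm x \<Longrightarrow> ereal c < h x"
    unfolding eventually_at_infinity by blast
  then show ?thesis by (meson linear not_less)
qed

section \<open>Gradients\<close>

lemma gradient_eqI:
  assumes "GDERIV f x :> D"
  shows "gradient f x = D"
  unfolding gradient_def
proof (rule the_equality)
  fix D' assume "GDERIV f x :> D'"
  then have "(\<lambda>h. inner h D') = (\<lambda>h. inner h D)"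
    using assms has_derivative_unique unfolding gderiv_def by blast
  then have "inner (D' - D) D' = inner (D' - D) D" by meson
  then have "inner (D' - D) (D' - D) = 0" by (simp add: inner_diff_right)
  then show "D' = D" by simp
qed (fact assms)

lemma GDERIV_gradient:
  fixes f :: "'a::euclidean_space \<Rightarrow> real"
  assumes "f differentiable (at x)"
  shows "GDERIV f x :> gradient f x"
proof -
  obtain f' where f': "(f has_derivative f') (at x)"
    using assms by (auto simp: differentiable_def)
  then have lin: "linear f'" by (rule has_derivative_linear)
  define D where "D = (\<Sum>b\<in>Basis. f' b *\<^sub>R b)"
  have "f' h = inner h D" for h
  proof -
    have "f' h = f' (\<Sum>b\<in>Basis. inner h b *\<^sub>R b)" by (simp add: euclidean_representation)
    also have "\<dots> = (\<Sum>b\<in>Basis. inner h b * f' b)"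
      using lin by (simp add: linear_sum linear_scale)
    also have "\<dots> = inner h D" by (simp add: D_def inner_sum_right mult.commute)
    finally show ?thesis .
  qed
  then have "GDERIV f x :> D" using f' unfolding gderiv_def by presburger
  then show ?thesis using gradient_eqI by metis
qed

text \<open>The descent lemma: along the segment from \<open>y\<close> to \<open>z\<close> the derivative of \<open>F\<close> minus its
  linearization grows at most linearly.\<close>

lemma lipschitz_gradient_upper_bound:
  fixes F :: "'a::real_inner \<Rightarrow> real"
  assumes grad: "\<And>y. GDERIV F y :> G y" and lip: "B-lipschitz_on UNIV G"
  shows "F z \<le> F y + inner (G y) (z - y) + B / 2 * (norm (z - y))\<^sup>2"
proof -
  define d where "d = z - y"
  define \<phi> where "\<phi> t = F (y + t *\<^sub>R d) - t * inner (G y) d - B / 2 * t\<^sup>2 * (norm d)\<^sup>2" for t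
  have "\<phi> 1 \<le> \<phi> 0"
  proof (rule DERIV_nonpos_imp_nonincreasing[of 0 1 \<phi>])
    fix t :: real assume t: "0 \<le> t" "t \<le> 1"
    have "((\<lambda>t. F (y + t *\<^sub>R d)) has_derivative (\<lambda>s. inner (s *\<^sub>R d) (G (y + t *\<^sub>R d)))) (at t)"
      by (rule has_derivative_compose[of "\<lambda>t. y + t *\<^sub>R d" "\<lambda>s. s *\<^sub>R d" _ _ F, simplified])
         (use grad[unfolded gderiv_def] in \<open>auto intro!: derivative_eq_intros\<close>)
    then have "((\<lambda>t. F (y + t *\<^sub>R d)) has_real_derivative inner (G (y + t *\<^sub>R d)) d) (at t)"
      by (rule has_derivative_imp_has_field_derivative) (simp add: inner_commute)
    then have D: "(\<phi> has_real_derivative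
        inner (G (y + t *\<^sub>R d)) d - inner (G y) d - B * t * (norm d)\<^sup>2) (at t)"
      unfolding \<phi>_def by (auto intro!: derivative_eq_intros)
    have "inner (G (y + t *\<^sub>R d) - G y) d \<le> norm (G (y + t *\<^sub>R d) - G y) * norm d"
      by (rule norm_cauchy_schwarz)
    also have "\<dots> \<le> (B * (t * norm d)) * norm d"
      using lipschitz_onD[OF lip, of "y + t *\<^sub>R d" y] t
      by (intro mult_right_mono) (simp_all add: dist_norm)
    finally have "inner (G (y + t *\<^sub>R d)) d - inner (G y) d - B * t * (norm d)\<^sup>2 \<le> 0"
      by (simp add: inner_diff_left power2_eq_square algebra_simps)
    with D show "\<exists>l. (\<phi> has_real_derivative l) (at t) \<and> l \<le> 0" by blast
  qed simp
  then show ?thesis by (simp add: \<phi>_def d_def)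
qed

lemma lipschitz_gradient_lower_bound:
  fixes F :: "'a::real_inner \<Rightarrow> real"
  assumes grad: "\<And>y. GDERIV F y :> G y" and lip: "B-lipschitz_on UNIV G"
  shows "F y + inner (G y) (z - y) - B / 2 * (norm (z - y))\<^sup>2 \<le> F z"
proof -
  have "B-lipschitz_on UNIV (\<lambda>y. - G y)"
    using lip by (simp add: lipschitz_on_def dist_minus)
  then show ?thesis
    using lipschitz_gradient_upper_bound[of "\<lambda>y. - F y" "\<lambda>y. - G y" B z y] grad
    by (simp add: GDERIV_minus)
qed

section \<open>Running best values of summable sequences\<close>

text \<open>The indices between \<open>k/2\<close> and \<open>k\<close> number at least \<open>k/2\<close>, and on each of them the sequence is at
  least its running best at \<open>k\<close>. So \<open>k/2\<close> times the running best is at most a block of the series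
  that starts at \<open>k/2\<close>, which the Cauchy criterion makes small.\<close>

lemma running_best_smallo:
  fixes a :: "nat \<Rightarrow> real"
  assumes nonneg: "\<And>k. 0 \<le> a k" and sum: "summable a"
  shows "running_best a \<in> o(\<lambda>k. 1 / real k)"
proof (rule landau_o.smallI)
  fix c :: real assume c: "c > 0"
  obtain N where N: "\<And>m n. m \<ge> N \<Longrightarrow> norm (sum a {m..<n}) < c / 2"
    using sum c unfolding summable_Cauchy by (meson half_gt_zero)
  show "\<forall>\<^sub>F k in sequentially. norm (running_best a k) \<le> c * norm (1 / real k)"
  proof (rule eventually_sequentiallyI[of "2 * N + 1"])
    fix k assume k: "2 * N + 1 \<le> k"
    define b where "b = running_best a k"
    have b_le: "b \<le> a i" if "i \<le> k" for i
      using that by (auto simp: b_def running_best_def)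
    have "b \<in> a ` {..k}" unfolding b_def running_best_def by (rule Min_in) auto
    then have b0: "0 \<le> b" using nonneg by auto
    have "real k / 2 * b \<le> real (Suc k - k div 2) * b"
      using b0 by (intro mult_right_mono) linarith+
    also have "\<dots> = (\<Sum>i\<in>{k div 2..<Suc k}. b)" by simp
    also have "\<dots> \<le> sum a {k div 2..<Suc k}" by (intro sum_mono b_le) auto
    also have "\<dots> < c / 2" using N[of "k div 2" "Suc k"] k by (simp only: real_norm_def) linarith
    finally show "norm (running_best a k) \<le> c * norm (1 / real k)"
      using b0 k by (simp add: b_def[symmetric] field_simps)
  qed
qed

lemma averages_bigo:
  fixes a :: "nat \<Rightarrow> real"
  assumes nonneg: "\<And>k. 0 \<le> a k" and sum: "summable a"
  shows "(\<lambda>K. 1 / real K * (\<Sum>k<K. a k)) \<in> O(\<lambda>K. 1 / real K)"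
proof (rule bigoI[of _ "suminf a"], intro always_eventually allI)
  fix K
  have "(\<Sum>k<K. a k) \<le> suminf a" "0 \<le> (\<Sum>k<K. a k)"
    using sum_le_suminf[OF sum] nonneg by (auto intro: sum_nonneg)
  then show "norm (1 / real K * (\<Sum>k<K. a k)) \<le> suminf a * norm (1 / real K)"
    by (simp add: divide_right_mono)
qed

section \<open>Convergence under the Kurdyka-Lojasiewicz property\<close>

text \<open>Write \<open>d k\<close> for the length of step \<open>k\<close> and \<open>s k\<close> for the excess of the value at \<open>y k\<close> over its
  limit. Near \<open>xs\<close>, concavity of the desingularizing function \<open>\<phi>\<close> turns the decrease of the values
  into \<open>2 * d (k+1) \<le> d k + b / a * (\<phi> (s (k+1)) - \<phi> (s (k+2)))\<close>. Hence
  \<open>norm (y (k+1) - xs) + d k + b / a * \<phi> (s (k+1))\<close> does not increase while the iterates stay in the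
  KL neighbourhood. It becomes arbitrarily small along the subsequence that tends to \<open>xs\<close>, so it
  keeps the iterates in the neighbourhood and forces them towards \<open>xs\<close>.\<close>

lemma KL_descent_convergence:
  fixes h :: "'a::real_inner \<Rightarrow> ereal" and y g :: "nat \<Rightarrow> 'a" and H :: "nat \<Rightarrow> real"
  assumes KL: "KL_property h xs"
    and acc: "accumulation_point y xs"
    and val: "\<And>k. h (y k) = ereal (H k)" and val_xs: "h xs = ereal Hs" and lim: "H \<longlonglongrightarrow> Hs"
    and a: "a > 0" and descent: "\<And>k. H (Suc k) + a * (norm (y (Suc k) - y k))\<^sup>2 \<le> H k"
    and b: "b \<ge> 0" and sub: "\<And>k. g k \<in> subdiff h (y (Suc k))"
      and g: "\<And>k. norm (g k) \<le> b * norm (y (Suc k) - y k)"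
  shows "y \<longlonglongrightarrow> xs"
proof -
  obtain \<eta> U \<phi> where \<eta>: "0 < \<eta>" and U: "open U" "xs \<in> U"
    and cont: "continuous_on {s. 0 \<le> s \<and> ereal s < \<eta>} \<phi>"
    and conc: "concave_on {s. 0 \<le> s \<and> ereal s < \<eta>} \<phi>"
    and pos: "\<And>s. 0 \<le> s \<Longrightarrow> ereal s < \<eta> \<Longrightarrow> 0 \<le> \<phi> s" and zero: "\<phi> 0 = 0"
    and der: "\<And>s. 0 < s \<Longrightarrow> ereal s < \<eta> \<Longrightarrow> \<phi> differentiable (at s) \<and> 0 < deriv \<phi> s"
    and ineq: "\<And>x. x \<in> U \<Longrightarrow> h xs < h x \<Longrightarrow> h x < h xs + \<eta> \<Longrightarrow>
           1 \<le> ereal (deriv \<phi> (real_of_ereal (h x - h xs))) * dist_zero (subdiff h x)"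
    using KL unfolding KL_property_def by blast
  let ?I = "{s. 0 \<le> s \<and> ereal s < \<eta>}"
  define s where "s k = H k - Hs" for k
  define d where "d k = norm (y (Suc k) - y k)" for k
  define C where "C = b / a"
  define V where "V k = norm (y (Suc k) - xs) + d k + C * \<phi> (s (Suc k))" for k
  have C: "C \<ge> 0" using a b by (simp add: C_def)
  have d0: "d k \<ge> 0" for k by (simp add: d_def)
  have s_desc: "s (Suc k) + a * (d k)\<^sup>2 \<le> s k" for k
    using descent[of k] by (simp add: s_def d_def)
  have "decseq H"
  proof (rule decseq_SucI)
    fix k
    have "0 \<le> a * (norm (y (Suc k) - y k))\<^sup>2" using a by simp
    then show "H (Suc k) \<le> H k" using descent[of k] by linarith
  qed
  then have s0: "s k \<ge> 0" for k
    using decseq_ge[OF _ lim, of k] by (simp add: s_def)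
  have s_lim: "s \<longlonglongrightarrow> 0"
    unfolding s_def using tendsto_diff[OF lim tendsto_const[of Hs]] by simp
  have small: "\<forall>\<^sub>F k in sequentially. ereal (s k) < \<eta>"
    using tendsto_ereal[OF s_lim] by (rule order_tendstoD(2)) (simp add: \<eta> flip: zero_ereal_def)
  have d_lim: "d \<longlonglongrightarrow> 0"
  proof -
    have "(\<lambda>k. (s k - s (Suc k)) / a) \<longlonglongrightarrow> (0 - 0) / a"
      by (intro tendsto_divide tendsto_diff s_lim LIMSEQ_Suc[OF s_lim] tendsto_const) (use a in simp)
    then have "(\<lambda>k. (s k - s (Suc k)) / a) \<longlonglongrightarrow> 0" by simp
    then have "(\<lambda>k. (d k)\<^sup>2) \<longlonglongrightarrow> 0"
    proof (rule Lim_null_comparison[rotated], intro always_eventually allI)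
      fix k show "norm ((d k)\<^sup>2) \<le> (s k - s (Suc k)) / a"
        using s_desc[of k] a by (simp add: field_simps)
    qed
    from tendsto_real_sqrt[OF this] show ?thesis by (simp add: d0)
  qed
  have \<phi>_lim: "(\<lambda>k. \<phi> (s k)) \<longlonglongrightarrow> 0"
  proof -
    have "(\<lambda>k. \<phi> (s k)) \<longlonglongrightarrow> \<phi> 0"
      by (rule continuous_on_tendsto_compose[OF cont s_lim])
         (use \<eta> small s0 in \<open>auto simp flip: zero_ereal_def elim: eventually_mono\<close>)
    then show ?thesis by (simp add: zero)
  qed
  have step: "2 * d (Suc k) \<le> d k + C * (\<phi> (s (Suc k)) - \<phi> (s (Suc (Suc k))))"
    if yU: "y (Suc k) \<in> U" and sm: "ereal (s (Suc k)) < \<eta>" for k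
  proof (cases "s (Suc k) = 0")
    case True
    have "s (Suc (Suc k)) + a * (d (Suc k))\<^sup>2 \<le> 0" using s_desc[of "Suc k"] True by simp
    moreover have "0 \<le> a * (d (Suc k))\<^sup>2" using a by simp
    ultimately have "s (Suc (Suc k)) = 0" "a * (d (Suc k))\<^sup>2 = 0"
      using s0[of "Suc (Suc k)"] by linarith+
    then show ?thesis using True a d0[of k] by simp
  next
    case False
    let ?s = "s (Suc k)" and ?t = "s (Suc (Suc k))"
    define D where "D = deriv \<phi> ?s"
    have sp: "?s > 0" using False s0[of "Suc k"] by simp
    have "0 \<le> a * (d (Suc k))\<^sup>2" using a by simp
    then have ts: "?t \<le> ?s" using s_desc[of "Suc k"] by linarith
    have Dpos: "D > 0" and Dder: "(\<phi> has_real_derivative D) (at ?s)"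
      using der[OF sp sm] by (auto simp: D_def DERIV_deriv_iff_real_differentiable)
    have tangent: "\<phi> ?t - \<phi> ?s \<le> D * (?t - ?s)"
    proof -
      have "open {s. 0 < s \<and> ereal s < \<eta>}"
      proof -
        have "{s. 0 < s \<and> ereal s < \<eta>} = {0<..} \<inter> (ereal -` {..<\<eta>})" by auto
        moreover have "open (ereal -` {..<\<eta>})"
          by (intro open_vimage continuous_on_ereal continuous_on_id) simp
        ultimately show ?thesis by (simp add: open_Int)
      qed
      then have int: "?s \<in> interior ?I"
        by (rule interiorI) (use sp sm in auto)
      have conn: "connected ?I"
        by (rule convex_connected) (use conc in \<open>simp add: concave_on_def convex_on_def\<close>)
      have "ereal ?t < \<eta>" using ts sm by (metis ereal_less_eq(3) le_less_trans)
      then have "- D * (?t - ?s) \<le> - \<phi> ?t - (- \<phi> ?s)"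
        using conc s0[of "Suc (Suc k)"]
        by (intro convex_on_imp_above_tangent[OF _ conn int])
           (auto simp: concave_on_def intro: DERIV_minus[OF DERIV_subset[OF Dder]])
      then show ?thesis by simp
    qed
    have KLk: "1 \<le> D * (b * d k)"
    proof -
      have "dist_zero (subdiff h (y (Suc k))) \<le> ereal (norm (g k))"
        unfolding dist_zero_def by (rule INF_lower[OF sub])
      also have "\<dots> \<le> ereal (b * d k)" using g[of k] by (simp add: d_def)
      finally have "ereal D * dist_zero (subdiff h (y (Suc k))) \<le> ereal D * ereal (b * d k)"
        using Dpos by (intro ereal_mult_left_mono) auto
      moreover have "1 \<le> ereal D * dist_zero (subdiff h (y (Suc k)))"
      proof -
        have "h xs < h (y (Suc k))" using sp by (simp add: val val_xs s_def)
        moreover have "h (y (Suc k)) < h xs + \<eta>"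
          using sm unfolding val val_xs s_def by (cases \<eta>) auto
        moreover have "real_of_ereal (h (y (Suc k)) - h xs) = ?s" by (simp add: val val_xs s_def)
        ultimately show ?thesis using ineq[OF yU] by (simp add: D_def)
      qed
      ultimately have "1 \<le> ereal D * ereal (b * d k)" by (rule order_trans[rotated])
      then show ?thesis by simp
    qed
    define P where "P = C * (\<phi> ?s - \<phi> ?t)"
    have st: "a * (d (Suc k))\<^sup>2 \<le> ?s - ?t" using s_desc[of "Suc k"] by simp
    have diff: "D * (?s - ?t) \<le> \<phi> ?s - \<phi> ?t" using tangent by (simp add: algebra_simps)
    have "0 \<le> D * (?s - ?t)" using Dpos ts by simp
    then have P0: "0 \<le> P" unfolding P_def using C diff by (intro mult_nonneg_nonneg) linarith+
    have "a * (d (Suc k))\<^sup>2 \<le> (D * (b * d k)) * (?s - ?t)"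
      using mult_right_mono[OF KLk, of "?s - ?t"] st ts by simp
    also have "\<dots> = b * d k * (D * (?s - ?t))" by simp
    also have "\<dots> \<le> b * d k * (\<phi> ?s - \<phi> ?t)"
      using diff b d0 by (intro mult_left_mono) auto
    finally have "(d (Suc k))\<^sup>2 \<le> d k * P"
      using a by (simp add: P_def C_def field_simps)
    moreover have "4 * (d k * P) \<le> (d k + P)\<^sup>2"
      using zero_le_power2[of "d k - P"] by (simp add: power2_eq_square algebra_simps)
    ultimately have "(2 * d (Suc k))\<^sup>2 \<le> (d k + P)\<^sup>2" by (simp add: power_mult_distrib)
    then show ?thesis
      unfolding P_def[symmetric] by (rule power2_le_imp_le) (use P0 d0 in simp)
  qed
  have V_mono: "V (Suc k) \<le> V k" if "y (Suc k) \<in> U" "ereal (s (Suc k)) < \<eta>" for k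
  proof -
    have "norm (y (Suc (Suc k)) - xs) \<le> norm (y (Suc k) - xs) + d (Suc k)"
      using norm_triangle_ineq[of "y (Suc (Suc k)) - y (Suc k)" "y (Suc k) - xs"] by (simp add: d_def)
    with step[OF that] show ?thesis by (simp add: V_def algebra_simps)
  qed
  obtain \<sigma> where \<sigma>: "strict_mono \<sigma>" and sub_lim: "(y \<circ> \<sigma>) \<longlonglongrightarrow> xs"
    using acc by (auto simp: accumulation_point_def)
  have V_sub: "(\<lambda>j. V (\<sigma> j)) \<longlonglongrightarrow> 0"
  proof (rule Lim_null_comparison)
    have "(\<lambda>j. norm ((y \<circ> \<sigma>) j - xs) + 2 * d (\<sigma> j) + C * \<phi> (s (Suc (\<sigma> j)))) \<longlonglongrightarrow> 0 + 2 * 0 + C * 0"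
      using LIMSEQ_subseq_LIMSEQ[OF d_lim \<sigma>] LIMSEQ_subseq_LIMSEQ[OF LIMSEQ_Suc[OF \<phi>_lim] \<sigma>]
      by (intro tendsto_add tendsto_mult tendsto_const)
         (use LIM_zero[OF sub_lim] in \<open>auto simp: o_def intro: tendsto_norm_zero\<close>)
    then show "(\<lambda>j. norm ((y \<circ> \<sigma>) j - xs) + 2 * d (\<sigma> j) + C * \<phi> (s (Suc (\<sigma> j)))) \<longlonglongrightarrow> 0" by simp
    have "\<forall>\<^sub>F j in sequentially. ereal (s (Suc (\<sigma> j))) < \<eta>"
      using small[unfolded eventually_sequentially_Suc[of "\<lambda>k. ereal (s k) < \<eta>", symmetric]]
        filterlim_subseq[OF \<sigma>] by (rule eventually_compose_filterlim)
    then show "\<forall>\<^sub>F j in sequentially. norm (V (\<sigma> j)) \<le>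
        norm ((y \<circ> \<sigma>) j - xs) + 2 * d (\<sigma> j) + C * \<phi> (s (Suc (\<sigma> j)))"
    proof (rule eventually_mono)
      fix j assume "ereal (s (Suc (\<sigma> j))) < \<eta>"
      then have "0 \<le> C * \<phi> (s (Suc (\<sigma> j)))" using pos s0 C by simp
      then have "0 \<le> V (\<sigma> j)" using d0 by (simp add: V_def)
      moreover have "norm (y (Suc (\<sigma> j)) - xs) \<le> norm (y (\<sigma> j) - xs) + d (\<sigma> j)"
        using norm_triangle_ineq[of "y (Suc (\<sigma> j)) - y (\<sigma> j)" "y (\<sigma> j) - xs"] by (simp add: d_def)
      ultimately show "norm (V (\<sigma> j)) \<le>
          norm ((y \<circ> \<sigma>) j - xs) + 2 * d (\<sigma> j) + C * \<phi> (s (Suc (\<sigma> j)))"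
        by (simp add: V_def)
    qed
  qed
  obtain \<rho> where \<rho>: "\<rho> > 0" "ball xs \<rho> \<subseteq> U" using U openE by blast
  obtain N0 where N0: "\<And>k. k \<ge> N0 \<Longrightarrow> ereal (s k) < \<eta>"
    using small by (auto simp: eventually_sequentially)
  have near: "norm (y (Suc k) - xs) \<le> V k" if "k \<ge> N0" for k
    using N0[of "Suc k"] that pos[of "s (Suc k)"] s0 C d0[of k] by (simp add: V_def)
  have "(\<lambda>k. y (Suc k)) \<longlonglongrightarrow> xs"
  proof (rule LIMSEQ_I)
    fix e :: real assume "e > 0"
    define \<epsilon> where "\<epsilon> = min e \<rho>"
    have "\<epsilon> > 0" using \<open>e > 0\<close> \<rho> by (simp add: \<epsilon>_def)
    then have "\<forall>\<^sub>F j in sequentially. V (\<sigma> j) < \<epsilon>" by (rule order_tendstoD(2)[OF V_sub])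
    then have "\<forall>\<^sub>F j in sequentially. V (\<sigma> j) < \<epsilon> \<and> \<sigma> j \<ge> N0"
      using filterlim_subseq[OF \<sigma>] by (intro eventually_conj) (auto simp: filterlim_at_top)
    then obtain j where j: "V (\<sigma> j) < \<epsilon>" "\<sigma> j \<ge> N0"
      using eventually_happens by fastforce
    have V_small: "V k < \<epsilon>" if "k \<ge> \<sigma> j" for k
      using that
    proof (induction k rule: dec_induct)
      case base then show ?case using j by simp
    next
      case (step k)
      have "norm (y (Suc k) - xs) < \<rho>" using near[of k] step j by (simp add: \<epsilon>_def)
      then have "y (Suc k) \<in> U" using \<rho>(2) by (auto simp: dist_norm norm_minus_commute)
      then have "V (Suc k) \<le> V k" using N0[of "Suc k"] step j by (intro V_mono) auto
      then show ?case using step by simp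
    qed
    have "norm (y (Suc k) - xs) < e" if "k \<ge> \<sigma> j" for k
      using near[of k] V_small[of k] that j by (simp add: \<epsilon>_def)
    then show "\<exists>no. \<forall>k\<ge>no. norm (y (Suc k) - xs) < e" by blast
  qed
  then show ?thesis by (rule LIMSEQ_imp_Suc)
qed

section \<open>The proximal gradient method\<close>

text \<open>Comparing the values of the proximal objective at its minimizer and at \<open>u\<close> and expanding the
  squares shows that a minimizer is supported from below by a concave paraboloid, whose slope is the
  subgradient that the proximal step determines.\<close>

lemma prox_quadratic_support:
  fixes R :: "'a::real_inner \<Rightarrow> ereal"
  assumes R: "proper R" and \<alpha>: "\<alpha> > 0"
    and z: "z \<in> prox (\<lambda>u. ereal \<alpha> * R u) v"
  shows "\<bar>R z\<bar> \<noteq> \<infinity>"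
    and "R z + ereal (inner ((1 / \<alpha>) *\<^sub>R (v - z)) (u - z) - 1 / (2 * \<alpha>) * (norm (u - z))\<^sup>2) \<le> R u"
proof -
  have ninf: "R u \<noteq> -\<infinity>" for u using R by (simp add: proper_def)
  obtain u0 where u0: "R u0 \<noteq> \<infinity>" using R by (auto simp: proper_def)
  have le: "ereal \<alpha> * R z + ereal (1/2 * (norm (z - v))\<^sup>2)
      \<le> ereal \<alpha> * R u + ereal (1/2 * (norm (u - v))\<^sup>2)" for u
    using z by (simp add: prox_def is_arg_min_linorder)
  obtain b0 where b0: "R u0 = ereal b0" using u0 ninf[of u0] by (cases "R u0") auto
  have "R z \<noteq> \<infinity>" using le[of u0] b0 \<alpha> by auto
  then obtain a where a: "R z = ereal a" using ninf[of z] by (cases "R z") auto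
  then show "\<bar>R z\<bar> \<noteq> \<infinity>" by simp
  show "R z + ereal (inner ((1 / \<alpha>) *\<^sub>R (v - z)) (u - z) - 1 / (2 * \<alpha>) * (norm (u - z))\<^sup>2) \<le> R u"
  proof (cases "R u")
    case (real b)
    have "u - v = (u - z) - (v - z)" by simp
    then have n: "(norm (u - v))\<^sup>2 = (norm (u - z))\<^sup>2 - 2 * inner (v - z) (u - z) + (norm (z - v))\<^sup>2"
      by (simp only: power2_norm_eq_inner) (simp add: inner_diff inner_commute algebra_simps)
    have "\<alpha> * a + 1/2 * (norm (z - v))\<^sup>2 \<le> \<alpha> * b + 1/2 * (norm (u - v))\<^sup>2"
      using le[of u] a real by simp
    then have "\<alpha> * a + inner (v - z) (u - z) - 1/2 * (norm (u - z))\<^sup>2 \<le> \<alpha> * b"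
      unfolding n by (simp add: algebra_simps)
    then have "a + (inner (v - z) (u - z) / \<alpha> - 1 / (2 * \<alpha>) * (norm (u - z))\<^sup>2) \<le> b"
      using \<alpha> by (simp add: field_simps)
    then show ?thesis using a real by simp
  qed (use ninf in auto)
qed

lemma accumulation_point_Suc:
  assumes "accumulation_point x l"
  shows "accumulation_point (\<lambda>k. x (Suc k)) l"
proof -
  obtain \<sigma> where \<sigma>: "strict_mono \<sigma>" "(x \<circ> \<sigma>) \<longlonglongrightarrow> l"
    using assms by (auto simp: accumulation_point_def)
  define \<tau> where "\<tau> j = \<sigma> (Suc j) - 1" for j
  have pos: "\<sigma> (Suc j) > 0" for j
    using strict_monoD[OF \<sigma>(1), of j "Suc j"] by simp
  then have Suc_\<tau>: "Suc (\<tau> j) = \<sigma> (Suc j)" for j by (simp add: \<tau>_def)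
  have "strict_mono \<tau>"
  proof (rule strict_monoI_Suc)
    fix j
    have "Suc (\<tau> j) < Suc (\<tau> (Suc j))"
      unfolding Suc_\<tau> using \<sigma>(1) by (simp add: strict_mono_less)
    then show "\<tau> j < \<tau> (Suc j)" by simp
  qed
  moreover have "((\<lambda>k. x (Suc k)) \<circ> \<tau>) \<longlonglongrightarrow> l"
    using LIMSEQ_Suc[OF \<sigma>(2)] by (simp add: o_def Suc_\<tau>)
  ultimately show ?thesis by (auto simp: accumulation_point_def)
qed

text \<open>Two constants describe the smooth part \<open>F\<close>. The one-sided curvature bound \<open>M\<close> decides which
  step sizes give descent, so its sharpness matters; the Lipschitz constant \<open>B\<close> of the gradient only
  scales estimates of subgradients, so any value will do. The initial point may lie outside the
  domain of \<open>R\<close>, so values of the objective are followed from \<open>x 1\<close> on, and index \<open>k\<close> of the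
  derived sequences belongs to the iterate \<open>x (Suc k)\<close>.\<close>

locale proximal_gradient =
  fixes F :: "'a::euclidean_space \<Rightarrow> real" and G :: "'a \<Rightarrow> 'a" and R :: "'a \<Rightarrow> ereal"
    and \<alpha> M B :: real and x :: "nat \<Rightarrow> 'a"
  assumes F_grad: "\<And>y. GDERIV F y :> G y"
    and G_lip: "B-lipschitz_on UNIV G"
    and F_upper: "\<And>y z. F z \<le> F y + inner (G y) (z - y) + M / 2 * (norm (z - y))\<^sup>2"
    and R_proper: "proper R"
    and lsc: "lower_semicontinuous (\<lambda>y. ereal (F y) + R y)"
    and sublevel: "\<And>c. bounded {y. ereal (F y) + R y \<le> ereal c}"
    and \<alpha>_pos: "\<alpha> > 0"
    and step: "ereal_convex R \<and> \<alpha> * M < 2 \<or> \<alpha> * M < 1"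
    and iter: "\<And>k. x (Suc k) \<in> prox (\<lambda>u. ereal \<alpha> * R u) (x k - \<alpha> *\<^sub>R G (x k))"
begin

definition objective :: "'a \<Rightarrow> ereal" where
  "objective y = ereal (F y) + R y"

definition R_subgrad :: "nat \<Rightarrow> 'a" where
  "R_subgrad k = (1 / \<alpha>) *\<^sub>R (x k - \<alpha> *\<^sub>R G (x k) - x (Suc k))"

definition objective_subgrad :: "nat \<Rightarrow> 'a" where
  "objective_subgrad k = G (x (Suc k)) + R_subgrad k"

definition R_val :: "nat \<Rightarrow> real" where
  "R_val k = real_of_ereal (R (x (Suc k)))"

definition val :: "nat \<Rightarrow> real" where
  "val k = F (x (Suc k)) + R_val k"

definition decrease :: real where
  "decrease = (if ereal_convex R then 1 / \<alpha> else 1 / (2 * \<alpha>)) - M / 2"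

lemma R_not_MInfty: "R y \<noteq> -\<infinity>"
  using R_proper by (simp add: proper_def)

lemma R_iterate: "R (x (Suc k)) = ereal (R_val k)"
  using prox_quadratic_support(1)[OF R_proper \<alpha>_pos iter] by (simp add: R_val_def ereal_real)

lemma objective_iterate: "objective (x (Suc k)) = ereal (val k)"
  by (simp add: objective_def R_iterate val_def)

lemma R_quadratic_support:
  "ereal (R_val k + inner (R_subgrad k) (u - x (Suc k)) - 1 / (2 * \<alpha>) * (norm (u - x (Suc k)))\<^sup>2) \<le> R u"
  using prox_quadratic_support(2)[OF R_proper \<alpha>_pos iter, of k u]
  by (simp add: R_iterate R_subgrad_def add_diff_eq)

lemma R_convex_support:
  assumes "ereal_convex R"
  shows "ereal (R_val k + inner (R_subgrad k) (u - x (Suc k))) \<le> R u"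
proof -
  have "x (Suc k) = (x k - \<alpha> *\<^sub>R G (x k)) - \<alpha> *\<^sub>R R_subgrad k"
    using \<alpha>_pos by (simp add: R_subgrad_def)
  then have "R_subgrad k \<in> subdiff R (x (Suc k))"
    by (rule prox_subgradient[OF R_proper \<alpha>_pos iter])
  then show ?thesis
    using subdiff_convex[OF assms R_not_MInfty] by (simp add: convex_subdiff_def R_iterate)
qed

lemma continuous_F: "isCont F y"
  using F_grad has_derivative_continuous unfolding gderiv_def by blast

lemma continuous_G: "isCont G y"
  using lipschitz_on_continuous_on[OF G_lip] by (simp add: continuous_on_eq_continuous_at)

lemma decrease_pos: "decrease > 0"
  using step \<alpha>_pos by (auto simp: decrease_def field_simps)

text \<open>For convex \<open>R\<close> the support of \<open>R\<close> at the new iterate is affine instead of quadratic. This gains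
  another \<open>1 / (2 * \<alpha>)\<close> in the decrease and hence allows step sizes up to \<open>2 / M\<close>.\<close>

lemma val_descent:
  "val (Suc k) + decrease * (norm (x (Suc (Suc k)) - x (Suc k)))\<^sup>2 \<le> val k"
proof -
  let ?u = "x (Suc k)" and ?z = "x (Suc (Suc k))"
  let ?n = "(norm (?z - ?u))\<^sup>2"
  define e where "e = (if ereal_convex R then 0 else 1 / (2 * \<alpha>))"
  have sup: "R_val (Suc k) + inner (R_subgrad (Suc k)) (?u - ?z) - e * ?n \<le> R_val k"
    using R_convex_support[of "Suc k" ?u] R_quadratic_support[of "Suc k" ?u]
    by (auto simp: e_def R_iterate norm_minus_commute)
  have "R_subgrad (Suc k) = - ((1 / \<alpha>) *\<^sub>R (?z - ?u)) - G ?u"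
    using \<alpha>_pos by (simp add: R_subgrad_def algebra_simps)
  then have "inner (R_subgrad (Suc k)) (?u - ?z) = inner ((1 / \<alpha>) *\<^sub>R (?z - ?u) + G ?u) (?z - ?u)"
    by (simp add: inner_diff_left inner_diff_right inner_add_left)
  also have "\<dots> = ?n / \<alpha> + inner (G ?u) (?z - ?u)"
    by (simp add: inner_add_left power2_norm_eq_inner)
  finally have "R_val (Suc k) + (?n / \<alpha> + inner (G ?u) (?z - ?u)) - e * ?n \<le> R_val k"
    using sup by simp
  moreover have "decrease * ?n = ?n / \<alpha> - e * ?n - M / 2 * ?n"
    using \<alpha>_pos by (simp add: decrease_def e_def field_simps)
  ultimately show ?thesis
    using F_upper[of ?z ?u] unfolding val_def by linarith
qed

lemma decseq_val: "decseq val"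
proof (rule decseq_SucI)
  fix k
  have "0 \<le> decrease * (norm (x (Suc (Suc k)) - x (Suc k)))\<^sup>2"
    using decrease_pos by simp
  then show "val (Suc k) \<le> val k" using val_descent[of k] by linarith
qed

lemma accumulation_point_exists: "\<exists>xs. accumulation_point x xs"
proof -
  have "range (\<lambda>k. x (Suc k)) \<subseteq> {y. ereal (F y) + R y \<le> ereal (val 0)}"
    using decseqD[OF decseq_val, of 0] objective_iterate by (auto simp: objective_def)
  then have "bounded (range (\<lambda>k. x (Suc k)))"
    using sublevel bounded_subset by blast
  then obtain l \<sigma> where "strict_mono \<sigma>" "((\<lambda>k. x (Suc k)) \<circ> \<sigma>) \<longlonglongrightarrow> l"
    using bounded_imp_convergent_subsequence by blast
  then have "strict_mono (Suc \<circ> \<sigma>)" "(x \<circ> (Suc \<circ> \<sigma>)) \<longlonglongrightarrow> l"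
    by (auto simp: strict_mono_def o_def)
  then show ?thesis unfolding accumulation_point_def by blast
qed

text \<open>Lower semicontinuity makes the value at an accumulation point a finite lower bound of the
  decreasing sequence of values.\<close>

lemma accumulation_value_le:
  assumes "accumulation_point x xs"
  obtains v where "objective xs = ereal v" "\<And>k. v \<le> val k"
proof -
  obtain \<tau> where \<tau>: "strict_mono \<tau>" and lim: "(\<lambda>j. x (Suc (\<tau> j))) \<longlonglongrightarrow> xs"
    using accumulation_point_Suc[OF assms] by (auto simp: accumulation_point_def o_def)
  have le: "objective xs \<le> ereal (val k)" for k
  proof -
    have "objective xs \<le> liminf (\<lambda>j. objective (x (Suc (\<tau> j))))"
      using lower_semicontinuous_seq[OF lsc lim] by (simp add: objective_def)
    also have "\<dots> \<le> liminf (\<lambda>j. ereal (val k))"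
    proof (intro Liminf_mono eventually_sequentiallyI[of k])
      fix j assume "k \<le> j"
      then have "k \<le> \<tau> j" using seq_suble[OF \<tau>, of j] by simp
      then show "objective (x (Suc (\<tau> j))) \<le> ereal (val k)"
        using decseqD[OF decseq_val] by (simp add: objective_iterate)
    qed
    finally show ?thesis by (simp add: Liminf_const)
  qed
  moreover have "objective xs \<noteq> -\<infinity>" using R_not_MInfty[of xs] by (simp add: objective_def)
  ultimately obtain v where "objective xs = ereal v"
    using le[of 0] by (cases "objective xs") auto
  with le that show thesis by simp
qed

lemma convergent_val: "convergent val"
proof -
  obtain xs where "accumulation_point x xs" using accumulation_point_exists by blast
  then obtain v where "\<And>k. v \<le> val k" using accumulation_value_le by blast
  then show ?thesis using decseq_val by (metis convergentI decseq_convergent)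
qed

lemma summable_steps: "summable (\<lambda>k. (norm (x (Suc k) - x k))\<^sup>2)"
proof -
  obtain v where "val \<longlonglongrightarrow> v" using convergent_val by (auto simp: convergent_def)
  then have "summable (\<lambda>k. (val k - val (Suc k)) / decrease)"
    by (intro summable_divide telescope_summable')
  then have "summable (\<lambda>k. (norm (x (Suc (Suc k)) - x (Suc k)))\<^sup>2)"
  proof (rule summable_comparison_test'[where N = 0])
    fix k
    show "norm ((norm (x (Suc (Suc k)) - x (Suc k)))\<^sup>2) \<le> (val k - val (Suc k)) / decrease"
      using val_descent[of k] decrease_pos by (simp add: field_simps)
  qed
  then show ?thesis by (subst (asm) summable_Suc_iff)
qed

lemma steps_tendsto_0: "(\<lambda>k. x (Suc k) - x k) \<longlonglongrightarrow> 0"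
  using tendsto_real_sqrt[OF summable_LIMSEQ_zero[OF summable_steps]]
  by (simp add: tendsto_norm_zero_iff)

lemma objective_subgrad_eq:
  "objective_subgrad k = (G (x (Suc k)) - G (x k)) - (1 / \<alpha>) *\<^sub>R (x (Suc k) - x k)"
  using \<alpha>_pos by (simp add: objective_subgrad_def R_subgrad_def algebra_simps)

lemma norm_objective_subgrad_le:
  "norm (objective_subgrad k) \<le> (B + 1 / \<alpha>) * norm (x (Suc k) - x k)"
proof -
  have "norm (objective_subgrad k)
      \<le> norm (G (x (Suc k)) - G (x k)) + norm ((1 / \<alpha>) *\<^sub>R (x (Suc k) - x k))"
    unfolding objective_subgrad_eq by (rule norm_triangle_ineq4)
  also have "\<dots> \<le> B * norm (x (Suc k) - x k) + 1 / \<alpha> * norm (x (Suc k) - x k)"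
    using lipschitz_onD[OF G_lip, of "x (Suc k)" "x k"] \<alpha>_pos by (simp add: dist_norm)
  finally show ?thesis by (simp add: algebra_simps)
qed

lemma objective_subgrad_bound_nonneg: "0 \<le> B + 1 / \<alpha>"
  using lipschitz_on_nonneg[OF G_lip] \<alpha>_pos by simp

lemma summable_objective_subgrad: "summable (\<lambda>k. (norm (objective_subgrad k))\<^sup>2)"
proof (rule summable_comparison_test'[where N = 0])
  show "summable (\<lambda>k. (B + 1 / \<alpha>)\<^sup>2 * (norm (x (Suc k) - x k))\<^sup>2)"
    by (intro summable_mult summable_steps)
  show "norm ((norm (objective_subgrad k))\<^sup>2) \<le> (B + 1 / \<alpha>)\<^sup>2 * (norm (x (Suc k) - x k))\<^sup>2" for k
    using power_mono[OF norm_objective_subgrad_le[of k], of 2] by (simp add: power_mult_distrib)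
qed

lemma objective_subgrad_tendsto_0: "objective_subgrad \<longlonglongrightarrow> 0"
  using tendsto_real_sqrt[OF summable_LIMSEQ_zero[OF summable_objective_subgrad]]
  by (simp add: tendsto_norm_zero_iff)

lemma objective_subgrad_frechet: "objective_subgrad k \<in> frechet_subdiff objective (x (Suc k))"
proof (rule frechet_subdiffI)
  show "\<bar>objective (x (Suc k))\<bar> \<noteq> \<infinity>" by (simp add: objective_iterate)
  fix y
  let ?z = "x (Suc k)"
  have F: "F ?z + inner (G ?z) (y - ?z) - B / 2 * (norm (y - ?z))\<^sup>2 \<le> F y"
    by (rule lipschitz_gradient_lower_bound[OF F_grad G_lip])
  show "objective ?z + ereal (inner (objective_subgrad k) (y - ?z)
      - (B / 2 + 1 / (2 * \<alpha>)) * (norm (y - ?z))\<^sup>2) \<le> objective y"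
  proof (cases "R y")
    case (real s)
    then have "R_val k + inner (R_subgrad k) (y - ?z) - 1 / (2 * \<alpha>) * (norm (y - ?z))\<^sup>2 \<le> s"
      using R_quadratic_support[of k y] by simp
    then have "val k + (inner (objective_subgrad k) (y - ?z)
        - (B / 2 + 1 / (2 * \<alpha>)) * (norm (y - ?z))\<^sup>2) \<le> F y + s"
      using F unfolding val_def objective_subgrad_def inner_add_left distrib_right by linarith
    then show ?thesis using real unfolding objective_iterate by (simp add: objective_def)
  qed (use R_not_MInfty in \<open>auto simp: objective_def\<close>)
qed

text \<open>The upper half of the convergence of the values comes from the proximal step itself: its
  minimizer does at least as well as the accumulation point. Lower semicontinuity alone leaves
  a possible gap.\<close>

lemma val_tendsto:
  assumes acc: "accumulation_point x xs"
  obtains v where "objective xs = ereal v" "val \<longlonglongrightarrow> v"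
proof -
  obtain v where v: "objective xs = ereal v" and v_le: "\<And>k. v \<le> val k"
    using accumulation_value_le[OF acc] by blast
  obtain w where w: "val \<longlonglongrightarrow> w" using convergent_val by (auto simp: convergent_def)
  obtain s where s: "R xs = ereal s" "v = F xs + s"
    using v R_not_MInfty[of xs] by (cases "R xs") (auto simp: objective_def)
  obtain \<tau> where \<tau>: "strict_mono \<tau>" and lim: "(\<lambda>j. x (Suc (\<tau> j))) \<longlonglongrightarrow> xs"
    using accumulation_point_Suc[OF acc] by (auto simp: accumulation_point_def o_def)
  have lim0: "(\<lambda>j. x (\<tau> j)) \<longlonglongrightarrow> xs"
    using tendsto_diff[OF lim LIMSEQ_subseq_LIMSEQ[OF steps_tendsto_0 \<tau>]] by (simp add: o_def)
  have zeta: "(\<lambda>j. R_subgrad (\<tau> j)) \<longlonglongrightarrow> (1 / \<alpha>) *\<^sub>R (xs - \<alpha> *\<^sub>R G xs - xs)"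
    unfolding R_subgrad_def
    by (intro tendsto_intros lim lim0 isCont_tendsto_compose[OF continuous_G])
  define U where "U j = F (x (Suc (\<tau> j))) + s - inner (R_subgrad (\<tau> j)) (xs - x (Suc (\<tau> j)))
      + 1 / (2 * \<alpha>) * (norm (xs - x (Suc (\<tau> j))))\<^sup>2" for j
  have "U \<longlonglongrightarrow> F xs + s - inner ((1 / \<alpha>) *\<^sub>R (xs - \<alpha> *\<^sub>R G xs - xs)) (xs - xs)
      + 1 / (2 * \<alpha>) * (norm (xs - xs))\<^sup>2"
    unfolding U_def by (intro tendsto_intros lim zeta isCont_tendsto_compose[OF continuous_F])
  then have "U \<longlonglongrightarrow> v" using s by simp
  moreover have "(\<lambda>j. val (\<tau> j)) \<longlonglongrightarrow> w"
    using LIMSEQ_subseq_LIMSEQ[OF w \<tau>] by (simp add: o_def)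
  moreover have "val (\<tau> j) \<le> U j" for j
    using R_quadratic_support[of "\<tau> j" xs] s(1) by (simp add: val_def U_def)
  ultimately have "w \<le> v" by (intro LIMSEQ_le) auto
  moreover have "v \<le> w" using w v_le by (intro LIMSEQ_le_const) auto
  ultimately show thesis using that v w by simp
qed

lemma accumulation_point_stationary:
  assumes acc: "accumulation_point x xs"
  shows "0 \<in> subdiff objective xs"
proof -
  obtain v where v: "objective xs = ereal v" "val \<longlonglongrightarrow> v" using val_tendsto[OF acc] .
  obtain \<tau> where \<tau>: "strict_mono \<tau>" and lim: "(\<lambda>j. x (Suc (\<tau> j))) \<longlonglongrightarrow> xs"
    using accumulation_point_Suc[OF acc] by (auto simp: accumulation_point_def o_def)
  have "(\<lambda>j. objective (x (Suc (\<tau> j)))) \<longlonglongrightarrow> objective xs"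
    unfolding objective_iterate v using LIMSEQ_subseq_LIMSEQ[OF v(2) \<tau>] by (simp add: o_def)
  moreover have "(\<lambda>j. objective_subgrad (\<tau> j)) \<longlonglongrightarrow> 0"
    using LIMSEQ_subseq_LIMSEQ[OF objective_subgrad_tendsto_0 \<tau>] by (simp add: o_def)
  ultimately show ?thesis
    using lim v objective_subgrad_frechet unfolding subdiff_def by fastforce
qed

lemma KL_convergence:
  assumes acc: "accumulation_point x xs" and KL: "KL_property objective xs"
  shows "x \<longlonglongrightarrow> xs"
proof -
  obtain v where v: "objective xs = ereal v" "val \<longlonglongrightarrow> v" using val_tendsto[OF acc] .
  have "(\<lambda>k. x (Suc k)) \<longlonglongrightarrow> xs"
  proof (rule KL_descent_convergence[OF KL accumulation_point_Suc[OF acc] objective_iterate v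
        decrease_pos val_descent objective_subgrad_bound_nonneg])
    show "objective_subgrad (Suc k) \<in> subdiff objective (x (Suc (Suc k)))" for k
      using objective_subgrad_frechet frechet_subdiff_subset by blast
    show "norm (objective_subgrad (Suc k)) \<le> (B + 1 / \<alpha>) * norm (x (Suc (Suc k)) - x (Suc k))" for k
      by (rule norm_objective_subgrad_le)
  qed
  then show ?thesis by (rule LIMSEQ_imp_Suc)
qed

end

section \<open>Symmetric matrices and the Frobenius inner product\<close>

lemma inner_symmetric_matrix:
  fixes A :: "real^'n^'n"
  assumes "transpose A = A"
  shows "inner v (A *v w) = inner (A *v v) w"
  by (metis assms dot_lmul_matrix transpose_matrix_vector)

text \<open>Eigenvectors of distinct eigenvalues are orthogonal, and an orthogonal family of nonzero
  vectors is finite.\<close>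

lemma finite_eigenvalues_symmetric:
  fixes A :: "real^'n::finite^'n"
  assumes sym: "transpose A = A"
  shows "finite (eigenvalues A)"
proof -
  define e where "e l = (SOME v. v \<noteq> 0 \<and> A *v v = l *\<^sub>R v)" for l
  have e: "e l \<noteq> 0 \<and> A *v e l = l *\<^sub>R e l" if "l \<in> eigenvalues A" for l
    unfolding e_def by (rule someI_ex) (use that in \<open>auto simp: eigenvalues_def\<close>)
  have orth: "inner (e l) (e m) = 0" if "l \<in> eigenvalues A" "m \<in> eigenvalues A" "l \<noteq> m" for l m
  proof -
    have "m * inner (e l) (e m) = l * inner (e l) (e m)"
      using inner_symmetric_matrix[OF sym, of "e l" "e m"] e that by simp
    then show ?thesis using that by simp
  qed
  have "pairwise orthogonal (e ` eigenvalues A)"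
    using orth by (auto simp: pairwise_def orthogonal_def)
  moreover have "0 \<notin> e ` eigenvalues A" using e by auto
  ultimately have "finite (e ` eigenvalues A)"
    using pairwise_orthogonal_independent independent_imp_finite by blast
  moreover have "inj_on e (eigenvalues A)"
    using orth e by (intro inj_onI) (metis inner_eq_zero_iff)
  ultimately show ?thesis by (rule finite_imageD)
qed

text \<open>A minimizer of the Rayleigh quotient on the unit sphere is an eigenvector: with \<open>\<mu>\<close> the minimum,
  the form of \<open>A - \<mu> I\<close> is nonnegative and vanishes at the minimizer \<open>v\<close>. Moving from \<open>v\<close> against
  \<open>q = (A - \<mu> I) v\<close> would make the form negative unless \<open>q = 0\<close>.\<close>

lemma lambda_min_Rayleigh:
  fixes A :: "real^'n::finite^'n"
  assumes sym: "transpose A = A"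
  shows "lambda_min A * inner w w \<le> inner w (A *v w)"
proof -
  define S where "S = sphere (0::real^'n) 1"
  have "compact S" by (simp add: S_def)
  moreover have "axis undefined 1 \<in> S" by (simp add: S_def)
  moreover have "continuous_on S (\<lambda>v. inner v (A *v v))"
    by (intro continuous_intros linear_continuous_on matrix_vector_mul_bounded_linear)
  ultimately obtain v where v: "v \<in> S" and v_min: "\<And>u. u \<in> S \<Longrightarrow> inner v (A *v v) \<le> inner u (A *v u)"
    using continuous_attains_inf[of S "\<lambda>v. inner v (A *v v)"] by blast
  define \<mu> where "\<mu> = inner v (A *v v)"
  have vv: "inner v v = 1" using v by (simp add: S_def dist_norm norm_eq_sqrt_inner)
  have Rayleigh: "\<mu> * inner u u \<le> inner u (A *v u)" for u
  proof (cases "u = 0")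
    case False
    have "(1 / norm u) *\<^sub>R u \<in> S" using False by (simp add: S_def)
    then have "\<mu> \<le> inner ((1 / norm u) *\<^sub>R u) (A *v ((1 / norm u) *\<^sub>R u))"
      unfolding \<mu>_def by (rule v_min)
    also have "\<dots> = inner u (A *v u) / inner u u"
      by (simp add: matrix_vector_mult_scaleR power2_norm_eq_inner[symmetric] power2_eq_square)
    finally show ?thesis using False by (simp add: pos_le_divide_eq)
  qed simp
  define q where "q = A *v v - \<mu> *\<^sub>R v"
  define c where "c = inner q (A *v q) - \<mu> * inner q q"
  have vq: "inner v q = 0" by (simp add: q_def inner_diff_right \<mu>_def vv)
  have qAv: "inner q (A *v v) = inner q q"
    using vq by (simp add: q_def inner_diff_right inner_commute)
  have form: "0 \<le> t\<^sup>2 * c - 2 * t * inner q q" for t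
  proof -
    let ?u = "v - t *\<^sub>R q"
    have "inner ?u ?u = 1 + t\<^sup>2 * inner q q"
      using vq vv by (simp add: inner_diff_left inner_diff_right inner_commute power2_eq_square)
    moreover have "inner ?u (A *v ?u) = \<mu> - 2 * t * inner q q + t\<^sup>2 * inner q (A *v q)"
      using qAv inner_symmetric_matrix[OF sym, of v q]
      by (simp add: matrix_vector_mult_diff_distrib matrix_vector_mult_scaleR inner_diff_left
          inner_diff_right inner_commute power2_eq_square \<mu>_def algebra_simps)
    ultimately show ?thesis using Rayleigh[of ?u] by (simp add: c_def algebra_simps)
  qed
  have "inner q q = 0"
  proof (rule ccontr)
    assume "inner q q \<noteq> 0"
    then have q: "inner q q > 0" by simp
    have c: "c \<ge> 0" using Rayleigh[of q] by (simp add: c_def)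
    define t where "t = inner q q / (c + 1)"
    have t: "t > 0" using q c by (simp add: t_def)
    have "0 \<le> t * (t * c - 2 * inner q q)" using form[of t] by (simp add: power2_eq_square algebra_simps)
    then have "2 * inner q q \<le> t * c" using t by (simp add: zero_le_mult_iff)
    also have "\<dots> \<le> inner q q" using q c by (simp add: t_def field_simps)
    finally show False using q by simp
  qed
  then have "A *v v = \<mu> *\<^sub>R v" by (simp add: q_def)
  moreover have "v \<noteq> 0" using vv by auto
  ultimately have "\<mu> \<in> eigenvalues A" by (auto simp: eigenvalues_def)
  then have "lambda_min A \<le> \<mu>"
    unfolding lambda_min_def using finite_eigenvalues_symmetric[OF sym] by (rule Min_le[rotated])
  then have "lambda_min A * inner w w \<le> \<mu> * inner w w" by (rule mult_right_mono) simp
  with Rayleigh[of w] show ?thesis by simp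
qed

text \<open>The Frobenius inner product is the sum of the inner products of the columns, so a lower bound
  of a quadratic form carries over from vectors to \<open>n \<times> p\<close> matrices.\<close>

lemma inner_eq_sum_columns:
  fixes X Y :: "real^'p::finite^'n::finite"
  shows "inner X Y = (\<Sum>j\<in>UNIV. inner (column j X) (column j Y))"
  unfolding inner_vec_def column_def by (simp add: sum.swap[of _ "UNIV::'p set"])

lemma column_matrix_mult:
  fixes A :: "real^'n::finite^'m" and X :: "real^'p::finite^'n"
  shows "column j (A ** X) = A *v column j X"
  by (simp add: column_def matrix_matrix_mult_def matrix_vector_mult_def vec_eq_iff)

lemma Frobenius_form_lower_bound:
  fixes A :: "real^'n::finite^'n" and X :: "real^'p::finite^'n"
  assumes "\<And>v. c * inner v v \<le> inner v (A *v v)"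
  shows "c * inner X X \<le> inner X (A ** X)"
  unfolding inner_eq_sum_columns column_matrix_mult sum_distrib_left
  by (intro sum_mono assms)

lemma Frobenius_symmetric:
  fixes A :: "real^'n::finite^'n" and X Y :: "real^'p::finite^'n"
  assumes "transpose A = A"
  shows "inner X (A ** Y) = inner (A ** X) Y"
  unfolding inner_eq_sum_columns column_matrix_mult
  by (intro sum.cong refl inner_symmetric_matrix assms)

lemma matrix_mult_bounded_linear:
  fixes A :: "real^'n::finite^'m::finite"
  shows "bounded_linear (\<lambda>X::real^'p::finite^'n. A ** X)"
  by (rule linear_conv_bounded_linear[THEN iffD1], rule linearI)
    (simp_all add: matrix_add_ldistrib matrix_matrix_mult_def vec_eq_iff sum_distrib_left sum.distrib algebra_simps)

lemma matrix_diff_mult: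
  fixes A B :: "real^'n::finite^'m" and X :: "real^'p^'n"
  shows "(A - B) ** X = A ** X - B ** X"
  by (simp add: matrix_matrix_mult_def vec_eq_iff left_diff_distrib sum_subtractf)

lemma row_average_bounded_linear:
  "bounded_linear (row_average :: real^'p::finite^'n::finite \<Rightarrow> real^'p)"
  by (rule linear_conv_bounded_linear[THEN iffD1], rule linearI)
    (simp_all add: row_average_def vec_eq_iff vector_matrix_mult_def sum.distrib sum_distrib_left algebra_simps)

section \<open>The Lagrangian of decentralized optimization\<close>

lemma mixing_matrix_symmetric: "mixing_matrix E W \<Longrightarrow> transpose W = W"
  by (simp add: mixing_matrix_def)

lemma row_average_mixing:
  fixes X :: "real^'p::finite^'n::finite"
  assumes "mixing_matrix E W"
  shows "row_average (W ** X) = row_average X"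
proof -
  have "(1::real^'n) \<in> {v. (mat 1 - W) *v v = 0}"
    using assms by (simp add: mixing_matrix_def span_base)
  then have "W *v 1 = 1" by (simp add: matrix_vector_mult_diff_rdistrib)
  then have "(1::real^'n) v* W = 1"
    using mixing_matrix_symmetric[OF assms] by (metis transpose_matrix_vector)
  then show ?thesis by (simp add: row_average_def flip: vector_matrix_mul_assoc)
qed

lemma consensus_form_nonneg:
  fixes X :: "real^'p::finite^'n::finite"
  assumes "mixing_matrix E W"
  shows "0 \<le> inner X ((mat 1 - W) ** X)"
  using Frobenius_form_lower_bound[of 0 "mat 1 - W" X] assms by (simp add: mixing_matrix_def)

lemma consensus_form_upper_bound:
  fixes X :: "real^'p::finite^'n::finite"
  assumes "mixing_matrix E W"
  shows "inner X ((mat 1 - W) ** X) \<le> (1 - lambda_min W) * (norm X)\<^sup>2"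
  using Frobenius_form_lower_bound[OF lambda_min_Rayleigh[OF mixing_matrix_symmetric[OF assms]], of X]
  by (simp add: matrix_diff_mult inner_diff_right power2_norm_eq_inner algebra_simps)

lemma consensus_matrix_symmetric:
  "mixing_matrix E W \<Longrightarrow> transpose (mat 1 - W) = mat 1 - W"
  using mixing_matrix_symmetric[of E W] by (auto simp: transpose_def vec_eq_iff mat_def)

lemma GDERIV_smooth_lagrangian:
  fixes f :: "'n::finite \<Rightarrow> real^'p::finite \<Rightarrow> real"
  assumes W: "mixing_matrix E W" and f: "\<And>i y. f i differentiable (at y)"
  shows "GDERIV (smooth_lagrangian f W \<alpha>) x :> grad_rows f x + (1 / \<alpha>) *\<^sub>R ((mat 1 - W) ** x)"
proof -
  let ?Q = "mat 1 - W"
  have row: "((\<lambda>x. f i (x $ i)) has_derivative (\<lambda>h. inner (h $ i) (gradient (f i) (x $ i)))) (at x)" for i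
    by (rule has_derivative_compose[OF bounded_linear.has_derivative[OF bounded_linear_vec_nth has_derivative_ident]])
       (use GDERIV_gradient[OF f] in \<open>simp add: gderiv_def\<close>)
  have Q: "((\<lambda>x. ?Q ** x) has_derivative (\<lambda>h. ?Q ** h)) (at x)"
    by (rule bounded_linear_imp_has_derivative[OF matrix_mult_bounded_linear])
  have "((\<lambda>x. (\<Sum>i\<in>UNIV. f i (x $ i)) + 1 / (2 * \<alpha>) * inner x (?Q ** x)) has_derivative
      (\<lambda>h. (\<Sum>i\<in>UNIV. inner (h $ i) (gradient (f i) (x $ i)))
        + 1 / (2 * \<alpha>) * (inner x (?Q ** h) + inner h (?Q ** x)))) (at x)"
    by (intro has_derivative_add has_derivative_sum row has_derivative_mult_right
        has_derivative_inner has_derivative_ident Q)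
  moreover have "(\<Sum>i\<in>UNIV. inner (h $ i) (gradient (f i) (x $ i)))
        + 1 / (2 * \<alpha>) * (inner x (?Q ** h) + inner h (?Q ** x))
      = inner h (grad_rows f x + (1 / \<alpha>) *\<^sub>R (?Q ** x))" for h
    using Frobenius_symmetric[OF consensus_matrix_symmetric[OF W], of x h]
    by (simp add: inner_add_right grad_rows_def inner_vec_def[of h "\<chi> i. gradient (f i) (x $ i)"]
        inner_commute[of "?Q ** x" h])
  ultimately show ?thesis
    unfolding gderiv_def smooth_lagrangian_def[abs_def] by simp
qed

text \<open>The curvature of the consensus term is at most \<open>(1 - \<lambda>) / \<alpha>\<close> for the least eigenvalue \<open>\<lambda>\<close> of
  \<open>W\<close>; this is how the least eigenvalue enters the step size bounds.\<close>

lemma smooth_lagrangian_upper_bound: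
  fixes f :: "'n::finite \<Rightarrow> real^'p::finite \<Rightarrow> real"
  assumes W: "mixing_matrix E W" and f: "\<And>i y. f i differentiable (at y)"
    and lip: "\<And>i. L-lipschitz_on UNIV (gradient (f i))" and \<alpha>: "\<alpha> > 0"
  shows "smooth_lagrangian f W \<alpha> z \<le> smooth_lagrangian f W \<alpha> y
      + inner (grad_rows f y + (1 / \<alpha>) *\<^sub>R ((mat 1 - W) ** y)) (z - y)
      + (L + (1 - lambda_min W) / \<alpha>) / 2 * (norm (z - y))\<^sup>2"
proof -
  let ?Q = "mat 1 - W"
  define d where "d = z - y"
  have z: "z = y + d" by (simp add: d_def)
  have "(\<Sum>i\<in>UNIV. f i (z $ i)) \<le> (\<Sum>i\<in>UNIV. f i (y $ i) + inner (gradient (f i) (y $ i)) (d $ i)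
      + L / 2 * (norm (d $ i))\<^sup>2)"
    using lipschitz_gradient_upper_bound[OF GDERIV_gradient[OF f] lip]
    by (intro sum_mono) (simp add: d_def)
  also have "\<dots> = (\<Sum>i\<in>UNIV. f i (y $ i)) + inner (grad_rows f y) d + L / 2 * (norm d)\<^sup>2"
  proof -
    have "inner (grad_rows f y) d = (\<Sum>i\<in>UNIV. inner (gradient (f i) (y $ i)) (d $ i))"
      by (subst inner_vec_def) (simp add: grad_rows_def)
    moreover have "(norm d)\<^sup>2 = (\<Sum>i\<in>UNIV. (norm (d $ i))\<^sup>2)"
      unfolding power2_norm_eq_inner by (rule inner_vec_def)
    ultimately show ?thesis by (simp add: sum.distrib sum_distrib_left)
  qed
  finally have F: "(\<Sum>i\<in>UNIV. f i (z $ i))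
      \<le> (\<Sum>i\<in>UNIV. f i (y $ i)) + inner (grad_rows f y) d + L / 2 * (norm d)\<^sup>2" .
  have "inner z (?Q ** z) = inner y (?Q ** y) + 2 * inner (?Q ** y) d + inner d (?Q ** d)"
    using Frobenius_symmetric[OF consensus_matrix_symmetric[OF W], of y d]
    by (simp add: z matrix_add_ldistrib inner_add_left inner_add_right inner_commute[of d])
  also have "\<dots> \<le> inner y (?Q ** y) + 2 * inner (?Q ** y) d + (1 - lambda_min W) * (norm d)\<^sup>2"
    using consensus_form_upper_bound[OF W, of d] by simp
  finally have "1 / (2 * \<alpha>) * inner z (?Q ** z)
      \<le> 1 / (2 * \<alpha>) * (inner y (?Q ** y) + 2 * inner (?Q ** y) d + (1 - lambda_min W) * (norm d)\<^sup>2)"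
    using \<alpha> by (intro mult_left_mono) auto
  also have "\<dots> = 1 / (2 * \<alpha>) * inner y (?Q ** y) + inner ((1 / \<alpha>) *\<^sub>R (?Q ** y)) d
      + (1 - lambda_min W) / \<alpha> / 2 * (norm d)\<^sup>2"
    using \<alpha> by (simp add: field_simps)
  finally show ?thesis
    using F by (simp add: smooth_lagrangian_def inner_add_left add_divide_distrib distrib_right
        flip: d_def)
qed

lemma smooth_lagrangian_gradient_lipschitz:
  fixes f :: "'n::finite \<Rightarrow> real^'p::finite \<Rightarrow> real" and W :: "real^'n^'n"
  assumes lip: "\<And>i. L-lipschitz_on UNIV (gradient (f i))"
  shows "\<exists>B. B-lipschitz_on UNIV (\<lambda>x. grad_rows f x + c *\<^sub>R ((mat 1 - W) ** x))"
proof -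
  have L: "0 \<le> L" using lipschitz_on_nonneg[OF lip] .
  have "L-lipschitz_on UNIV (grad_rows f)"
  proof (rule lipschitz_onI)
    fix x y
    have "norm (grad_rows f x - grad_rows f y) \<le> norm (L *\<^sub>R (x - y))"
    proof (rule norm_le_componentwise_cart)
      fix i
      show "norm ((grad_rows f x - grad_rows f y) $ i) \<le> norm ((L *\<^sub>R (x - y)) $ i)"
        using lipschitz_onD[OF lip, of "x $ i" "y $ i" i] L by (simp add: grad_rows_def dist_norm)
    qed
    then show "dist (grad_rows f x) (grad_rows f y) \<le> L * dist x y" using L by (simp add: dist_norm)
  qed (rule L)
  moreover have "bounded_linear (\<lambda>x. c *\<^sub>R ((mat 1 - W) ** x))"
    by (intro bounded_linear_const_scaleR matrix_mult_bounded_linear)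
  then obtain K where "K-lipschitz_on UNIV (\<lambda>x::real^'p^'n. c *\<^sub>R ((mat 1 - W) ** x))"
    using bounded_linear.lipschitz_boundE by blast
  ultimately show ?thesis using lipschitz_on_add by blast
qed

lemma ereal_convex_row_sum:
  fixes r :: "'n::finite \<Rightarrow> real^'p \<Rightarrow> ereal"
  assumes conv: "\<And>i. ereal_convex (r i)" and ninf: "\<And>i y. r i y \<noteq> -\<infinity>"
  shows "ereal_convex (row_sum r)"
  unfolding ereal_convex_def
proof (intro allI ballI)
  fix x y :: "real^'p^'n" and t :: real assume t: "t \<in> {0<..<1}"
  let ?z = "(1 - t) *\<^sub>R x + t *\<^sub>R y"
  have scale: "ereal c * (\<Sum>i\<in>UNIV. r i (u $ i)) = (\<Sum>i\<in>UNIV. ereal c * r i (u $ i))"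
    if "c > 0" for c and u :: "real^'p^'n"
  proof (cases "\<exists>i. r i (u $ i) = \<infinity>")
    case True
    then obtain j where j: "r j (u $ j) = \<infinity>" by blast
    have "(\<Sum>i\<in>UNIV. r i (u $ i)) = \<infinity>" "(\<Sum>i\<in>UNIV. ereal c * r i (u $ i)) = \<infinity>"
      using j that by (auto simp: sum_Pinfty intro!: exI[of _ j])
    then show ?thesis using that by simp
  next
    case False
    then have "\<exists>s. r i (u $ i) = ereal s" for i
      using ninf[of i "u $ i"] by (cases "r i (u $ i)") auto
    then obtain s where "\<And>i. r i (u $ i) = ereal (s i)" by metis
    then show ?thesis by (simp add: sum_distrib_left)
  qed
  have "row_sum r ?z \<le> (\<Sum>i\<in>UNIV. ereal (1 - t) * r i (x $ i) + ereal t * r i (y $ i))"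
    unfolding row_sum_def using conv t by (intro sum_mono) (simp add: ereal_convex_def)
  also have "\<dots> = ereal (1 - t) * row_sum r x + ereal t * row_sum r y"
    using t by (simp add: sum.distrib scale row_sum_def)
  finally show "row_sum r ?z \<le> ereal (1 - t) * row_sum r x + ereal t * row_sum r y" .
qed

lemma proper_row_sum:
  fixes f :: "'n::finite \<Rightarrow> real^'p \<Rightarrow> real"
  assumes pr: "\<And>i. proper (\<lambda>y. ereal (f i y) + r i y)" and ninf: "\<And>i y. r i y \<noteq> -\<infinity>"
  shows "proper (row_sum r)"
proof -
  have "\<exists>y. r i y \<noteq> \<infinity>" for i
  proof -
    obtain y where "ereal (f i y) + r i y \<noteq> \<infinity>" using pr[of i] unfolding proper_def by blast
    then show ?thesis by (intro exI[of _ y]) auto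
  qed
  then obtain y where y: "\<And>i. r i (y i) \<noteq> \<infinity>" by metis
  then have "row_sum r (\<chi> i. y i) \<noteq> \<infinity>" by (simp add: row_sum_def sum_Pinfty)
  moreover have "row_sum r z \<noteq> -\<infinity>" for z
    unfolding row_sum_def using ninf by (intro sum_not_MInfty)
  ultimately show ?thesis unfolding proper_def by blast
qed

lemma lagrangian_eq_row_sum:
  "lagrangian f r W \<alpha> x = row_sum (\<lambda>i y. ereal (f i y) + r i y) x
     + ereal (1 / (2 * \<alpha>) * inner x ((mat 1 - W) ** x))"
proof -
  let ?S = "\<Sum>i\<in>UNIV. f i (x $ i)" and ?q = "1 / (2 * \<alpha>) * inner x ((mat 1 - W) ** x)"
  have swap: "a + b + c = a + c + b" for a b c :: ereal by (simp only: ac_simps)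
  have "lagrangian f r W \<alpha> x = (ereal ?S + ereal ?q) + row_sum r x"
    unfolding lagrangian_def smooth_lagrangian_def plus_ereal.simps(1) ..
  also have "\<dots> = (ereal ?S + row_sum r x) + ereal ?q"
    by (rule swap)
  also have "ereal ?S + row_sum r x = row_sum (\<lambda>i y. ereal (f i y) + r i y) x"
    unfolding row_sum_def sum.distrib sum_ereal ..
  finally show ?thesis .
qed

lemma lower_semicontinuous_lagrangian:
  fixes f :: "'n::finite \<Rightarrow> real^'p::finite \<Rightarrow> real"
  assumes lsc: "\<And>i. lower_semicontinuous (\<lambda>y. ereal (f i y) + r i y)"
    and ninf: "\<And>i y. r i y \<noteq> -\<infinity>"
  shows "lower_semicontinuous (lagrangian f r W \<alpha>)"
proof -
  have "lower_semicontinuous (\<lambda>x. \<Sum>i\<in>UNIV. ereal (f i (x $ i)) + r i (x $ i))"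
    using ninf by (intro lower_semicontinuous_sum lower_semicontinuous_compose[OF lsc]) auto
  moreover have "isCont (\<lambda>x. 1 / (2 * \<alpha>) * inner x ((mat 1 - W) ** x)) x" for x :: "real^'p^'n"
    by (intro continuous_intros linear_continuous_at matrix_mult_bounded_linear)
  ultimately show ?thesis
    unfolding lagrangian_eq_row_sum[abs_def] row_sum_def
    using ninf by (intro lower_semicontinuous_add lower_semicontinuous_continuous sum_not_MInfty) auto
qed

text \<open>Each \<open>f i + r i\<close> is bounded below, so a bound on their sum bounds every one of them, and
  coercivity then bounds every row. The quadratic term only helps, since it is nonnegative.\<close>

lemma lagrangian_sublevel_bounded:
  fixes f :: "'n::finite \<Rightarrow> real^'p::finite \<Rightarrow> real"
  assumes W: "mixing_matrix E W" and \<alpha>: "\<alpha> > 0"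
    and lsc: "\<And>i. lower_semicontinuous (\<lambda>y. ereal (f i y) + r i y)"
    and co: "\<And>i. coercive (\<lambda>y. ereal (f i y) + r i y)"
    and ninf: "\<And>i y. r i y \<noteq> -\<infinity>"
  shows "bounded {x. lagrangian f r W \<alpha> x \<le> ereal c}"
proof -
  let ?h = "\<lambda>i y. ereal (f i y) + r i y"
  have "\<exists>m::real. \<forall>y. ereal m \<le> ?h i y" for i
    using ninf by (intro coercive_lsc_bounded_below lsc co) auto
  then obtain m where m: "\<And>i y. ereal (m i) \<le> ?h i y" by metis
  have "\<exists>b. \<forall>y. ?h i y \<le> ereal (c - (\<Sum>j\<in>UNIV - {i}. m j)) \<longrightarrow> norm y \<le> b" for i
    using co by (rule coercive_sublevel_bounded)
  then obtain b where b: "\<And>i y. ?h i y \<le> ereal (c - (\<Sum>j\<in>UNIV - {i}. m j)) \<Longrightarrow> norm y \<le> b i"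
    by metis
  have "norm x \<le> (\<Sum>i\<in>UNIV. b i)" if x: "lagrangian f r W \<alpha> x \<le> ereal c" for x
  proof -
    have "row_sum ?h x + ereal 0 \<le> lagrangian f r W \<alpha> x"
      unfolding lagrangian_eq_row_sum using consensus_form_nonneg[OF W, of x] \<alpha>
      by (intro add_left_mono) simp
    then have sum_le: "(\<Sum>i\<in>UNIV. ?h i (x $ i)) \<le> ereal c"
      using x unfolding row_sum_def by simp
    have "norm (x $ i) \<le> b i" for i
    proof (rule b)
      have "?h i (x $ i) + ereal (\<Sum>j\<in>UNIV - {i}. m j) \<le> ?h i (x $ i) + (\<Sum>j\<in>UNIV - {i}. ?h j (x $ j))"
        unfolding sum_ereal[symmetric] by (intro add_left_mono sum_mono m)
      also have "\<dots> = (\<Sum>i\<in>UNIV. ?h i (x $ i))" by (rule sum.remove[symmetric]) auto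
      also note sum_le
      finally show "?h i (x $ i) \<le> ereal (c - (\<Sum>j\<in>UNIV - {i}. m j))"
        by (cases "?h i (x $ i)") auto
    qed
    then have "(\<Sum>i\<in>UNIV. norm (x $ i)) \<le> (\<Sum>i\<in>UNIV. b i)" by (rule sum_mono)
    moreover have "norm x \<le> (\<Sum>i\<in>UNIV. norm (x $ i))"
      unfolding norm_vec_def[of x] by (rule L2_set_le_sum) simp
    ultimately show ?thesis by simp
  qed
  then show ?thesis by (auto simp: bounded_iff)
qed

section \<open>Convergence of Prox-DGD\<close>

theorem theorem3:
  fixes f :: "'n::finite \<Rightarrow> real^'p::finite \<Rightarrow> real"
    and r :: "'n \<Rightarrow> real^'p \<Rightarrow> ereal"
    and L :: "'n \<Rightarrow> real"
    and E :: "('n \<times> 'n) set"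
    and W :: "real^'n^'n"
    and \<alpha> :: real
    and x \<xi> :: "nat \<Rightarrow> real^'p^'n"
  assumes graph: "connected_graph E"
    and W: "mixing_matrix E W"
    and f_diff: "\<And>i y. f i differentiable (at y)"
    and L_pos: "\<And>i. L i > 0"
    and f_lipschitz: "\<And>i. (L i)-lipschitz_on UNIV (gradient (f i))"
    and r_range: "\<And>i y. r i y \<noteq> -\<infinity>"
    and fr_proper: "\<And>i. proper (\<lambda>y. ereal (f i y) + r i y)"
    and fr_lsc: "\<And>i. lower_semicontinuous (\<lambda>y. ereal (f i y) + r i y)"
    and fr_coercive: "\<And>i. coercive (\<lambda>y. ereal (f i y) + r i y)"
    and \<alpha>_pos: "0 < \<alpha>"
    and step: "(\<forall>i. ereal_convex (r i)) \<and> \<alpha> < (1 + lambda_min W) / Max (range L)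
               \<or> \<alpha> < lambda_min W / Max (range L)"
    and iter: "prox_dgd f r W \<alpha> x"
    and \<xi>: "\<And>k. x (Suc k) = W ** x k - \<alpha> *\<^sub>R (grad_rows f (x k) + \<xi> (Suc k))"
  defines "Lhat \<equiv> lagrangian f r W \<alpha>"
    and "g \<equiv> \<lambda>k. gradient (smooth_lagrangian f W \<alpha>) (x k) + \<xi> k"
  shows "((\<exists>xs. accumulation_point x xs) \<and>
          (\<forall>xs. accumulation_point x xs \<longrightarrow> 0 \<in> subdiff Lhat xs))
       \<and> (running_best (\<lambda>k. (norm (x (Suc k) - x k))\<^sup>2) \<in> o(\<lambda>k. 1 / real k) \<and>
          running_best (\<lambda>k. (norm (g (Suc k)))\<^sup>2) \<in> o(\<lambda>k. 1 / real k) \<and>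
          running_best (\<lambda>k. (norm (row_average (grad_rows f (x k)) + row_average (\<xi> k)))\<^sup>2)
            \<in> o(\<lambda>k. 1 / real k))
       \<and> (\<lambda>K. 1 / real K * (\<Sum>k<K. (norm (row_average (grad_rows f (x k) + \<xi> k)))\<^sup>2))
            \<in> O(\<lambda>K. 1 / real K)
       \<and> (\<forall>xs. accumulation_point x xs \<and> KL_property Lhat xs \<longrightarrow> x \<longlonglongrightarrow> xs)"
proof -
  define Lf where "Lf = Max (range L)"
  define G where "G y = grad_rows f y + (1 / \<alpha>) *\<^sub>R ((mat 1 - W) ** y)" for y
  define M where "M = Lf + (1 - lambda_min W) / \<alpha>"
  have L_le: "L i \<le> Lf" for i unfolding Lf_def by (rule Max_ge) auto
  have Lf_pos: "Lf > 0" using L_pos L_le less_le_trans by blast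
  have lip: "Lf-lipschitz_on UNIV (gradient (f i))" for i
    using f_lipschitz L_le by (rule lipschitz_on_le)
  obtain B where B: "B-lipschitz_on UNIV G"
    unfolding G_def[abs_def] using smooth_lagrangian_gradient_lipschitz[of Lf f, OF lip] by blast
  have grad: "GDERIV (smooth_lagrangian f W \<alpha>) y :> G y" for y
    unfolding G_def by (rule GDERIV_smooth_lagrangian[OF W f_diff])
  have Lhat: "Lhat = (\<lambda>y. ereal (smooth_lagrangian f W \<alpha> y) + row_sum r y)"
    unfolding Lhat_def lagrangian_def ..
  have grad_step: "W ** y - \<alpha> *\<^sub>R grad_rows f y = y - \<alpha> *\<^sub>R G y" for y
    using \<alpha>_pos by (simp add: G_def matrix_diff_mult scaleR_add_right algebra_simps)
  have \<alpha>M: "\<alpha> * M = \<alpha> * Lf + 1 - lambda_min W" using \<alpha>_pos by (simp add: M_def distrib_left)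
  \<comment> \<open>The conditions \<open>\<alpha> M < 2\<close> and \<open>\<alpha> M < 1\<close> of the general method are the two step size bounds.\<close>
  interpret proximal_gradient "smooth_lagrangian f W \<alpha>" G "row_sum r" \<alpha> M B x
  proof
    show "smooth_lagrangian f W \<alpha> z
        \<le> smooth_lagrangian f W \<alpha> y + inner (G y) (z - y) + M / 2 * (norm (z - y))\<^sup>2" for y z
      unfolding G_def M_def by (rule smooth_lagrangian_upper_bound[OF W f_diff lip \<alpha>_pos])
    show "ereal_convex (row_sum r) \<and> \<alpha> * M < 2 \<or> \<alpha> * M < 1"
      using step ereal_convex_row_sum[of r] r_range Lf_pos
      unfolding \<alpha>M Lf_def[symmetric] by (auto simp: pos_less_divide_eq)
    show "x (Suc k) \<in> prox (\<lambda>u. ereal \<alpha> * row_sum r u) (x k - \<alpha> *\<^sub>R G (x k))" for k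
      using iter by (simp add: prox_dgd_def grad_step)
    show "lower_semicontinuous (\<lambda>y. ereal (smooth_lagrangian f W \<alpha> y) + row_sum r y)"
      using lower_semicontinuous_lagrangian[of f r W \<alpha>, OF fr_lsc r_range]
      unfolding Lhat[unfolded Lhat_def] .
    show "bounded {y. ereal (smooth_lagrangian f W \<alpha> y) + row_sum r y \<le> ereal c}" for c
      using lagrangian_sublevel_bounded[of E W \<alpha> f r c, OF W \<alpha>_pos fr_lsc fr_coercive r_range]
      unfolding lagrangian_def .
  qed (fact grad B \<alpha>_pos proper_row_sum[of f r, OF fr_proper r_range])+
  have objective: "objective = Lhat" by (simp add: fun_eq_iff objective_def Lhat)
  have "x (Suc k) = (x k - \<alpha> *\<^sub>R G (x k)) - \<alpha> *\<^sub>R \<xi> (Suc k)" for k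
    using \<xi>[of k] unfolding grad_step[symmetric] by (simp add: scaleR_add_right)
  then have "R_subgrad k = \<xi> (Suc k)" for k
    using \<alpha>_pos by (simp add: R_subgrad_def)
  then have g: "g (Suc k) = objective_subgrad k" for k
    by (simp add: g_def objective_subgrad_def gradient_eqI[OF grad])
  \<comment> \<open>Averaging over the rows annihilates the consensus term of the gradient, because \<open>W\<close> is symmetric
    and fixes the all-ones vector.\<close>
  have avg: "row_average (grad_rows f (x k) + \<xi> k) = row_average (g k)" for k
  proof -
    interpret avg: bounded_linear "row_average :: real^'p^'n \<Rightarrow> real^'p"
      by (rule row_average_bounded_linear)
    show ?thesis
      by (simp add: g_def gradient_eqI[OF grad] G_def avg.add avg.scaleR avg.diff
          matrix_diff_mult row_average_mixing[OF W])
  qed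
  define a where "a k = (norm (row_average (grad_rows f (x k) + \<xi> k)))\<^sup>2" for k
  have summable_a: "summable a"
  proof -
    obtain C where C: "\<And>X :: real^'p^'n. norm (row_average X) \<le> norm X * C"
      using bounded_linear.bounded[OF row_average_bounded_linear] by blast
    \<comment> \<open>The term at index 0 contains the arbitrary \<open>\<xi> 0\<close>, so the comparison starts at index 1.\<close>
    have "summable (\<lambda>k. a (Suc k))"
    proof (rule summable_comparison_test'[where N = 0])
      show "summable (\<lambda>k. (norm (objective_subgrad k))\<^sup>2 * C\<^sup>2)"
        by (intro summable_mult2 summable_objective_subgrad)
      show "norm (a (Suc k)) \<le> (norm (objective_subgrad k))\<^sup>2 * C\<^sup>2" for k
        using power_mono[OF C[of "g (Suc k)"], of 2]
        by (simp add: a_def avg g power_mult_distrib)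
    qed
    then show ?thesis by (subst (asm) summable_Suc_iff)
  qed
  have a_eq: "(\<lambda>k. (norm (row_average (grad_rows f (x k)) + row_average (\<xi> k)))\<^sup>2) = a"
    by (simp add: a_def fun_eq_iff bounded_linear.axioms(1)[OF row_average_bounded_linear, THEN linear_add])
  show ?thesis
  proof (intro conjI allI impI)
    show "\<exists>xs. accumulation_point x xs" by (rule accumulation_point_exists)
    show "0 \<in> subdiff Lhat xs" if "accumulation_point x xs" for xs
      using accumulation_point_stationary[OF that] by (simp add: objective)
    show "running_best (\<lambda>k. (norm (x (Suc k) - x k))\<^sup>2) \<in> o(\<lambda>k. 1 / real k)"
      using summable_steps by (intro running_best_smallo) auto
    show "running_best (\<lambda>k. (norm (g (Suc k)))\<^sup>2) \<in> o(\<lambda>k. 1 / real k)"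
      unfolding g using summable_objective_subgrad by (intro running_best_smallo) auto
    show "running_best (\<lambda>k. (norm (row_average (grad_rows f (x k)) + row_average (\<xi> k)))\<^sup>2)
        \<in> o(\<lambda>k. 1 / real k)"
      unfolding a_eq by (intro running_best_smallo summable_a) (simp add: a_def)
    show "(\<lambda>K. 1 / real K * (\<Sum>k<K. (norm (row_average (grad_rows f (x k) + \<xi> k)))\<^sup>2))
        \<in> O(\<lambda>K. 1 / real K)"
      unfolding a_def[symmetric] by (intro averages_bigo summable_a) (simp add: a_def)
    show "x \<longlonglongrightarrow> xs" if "accumulation_point x xs \<and> KL_property Lhat xs" for xs
      using KL_convergence that by (simp add: objective)
  qed
qed

end
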